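(* Let $G$ be a connected graph of order $n\ge 2$ and let $\mathcal{H}=\{P_1,\dots,P_n\}$ be a family of $n$ paths, where the path $P_i\in\mathcal{H}$ has order $n_i$. Then the following statements hold. (i) If $n_i\ge 7$ for all $i\in\{1,\dots,n\}$, then $\dim_1(G\odot\mathcal{H})=\dim_1(G\odot\overline{\mathcal{H}})=\dim_1(G\odot(K_1\diamond\mathcal{H}))=\sum_{i=1}^{n}\left\lfloor\frac{2n_i+2}{5}\right\rfloor$. (ii) If $n_i\ge 6$ for all $i\in\{1,\dots,n\}$, then $\dim_2(G\odot\mathcal{H})=\dim_2(G\odot\overline{\mathcal{H}})=\dim_2(G\odot(K_1\diamond\mathcal{H}))=\sum_{i=1}^{n}\left\lceil\frac{n_i+1}{2}\right\rceil$. (iii) If $n_i\ge 6$ for all $i\in\{1,\dots,n\}$, then $\dim_3(G\odot\mathcal{H})=\dim_3(G\odot\overline{\mathcal{H}})=\dim_3(G\odot(K_1\diamond\mathcal{H}))=\sum_{i=1}^{n}\left(n_i-\left\lfloor\frac{n_i-4}{5}\right\rfloor\right)$.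
   Context: All graphs are finite, simple and undirected. $K_1+H$ is the join graph: $H$ together with one new vertex adjacent to every vertex of $H$. For a connected graph $\Gamma$, $d_\Gamma(x,y)$ is the length of a shortest path between $x$ and $y$. For a positive integer $k$, a set $S\subseteq V(\Gamma)$ is a $k$-metric generator for $\Gamma$ if for any two different vertices $u,v$ of $\Gamma$ there are at least $k$ vertices $w\in S$ with $d_\Gamma(u,w)\neq d_\Gamma(v,w)$. The minimum cardinality of a $k$-metric generator is the $k$-metric dimension $\dim_k(\Gamma)$; $\dim_1=\dim$ is the usual metric dimension. Corona product: if $G$ has vertices $v_1,\dots,v_n$ and $\mathcal{H}=\{H_1,\dots,H_n\}$ is a family of $n$ graphs (repetitions up to isomorphism allowed), $G\odot\mathcal{H}$ is obtained from the disjoint union of $G$ and $H_1,\dots,H_n$ by joining, for each $i$, the vertex $v_i$ by an edge to every vertex of $H_i$. $\overline{\mathcal{H}}=\{\overline{H}_1,\dots,\overline{H}_n\}$ is the family of the complement graphs, and $K_1\diamond\mathcal{H}=\{K_1+H_1,\dots,K_1+H_n\}$. *)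

theory Defs
  imports Complex_Main "Graph_Theory.Graph_Theory"
begin

text \<open>
  A finite simple undirected graph is a \<open>pair_graph\<close>: an undirected edge between \<open>x\<close> and \<open>y\<close> is
  represented by the two arcs \<open>(x, y)\<close> and \<open>(y, x)\<close>.
\<close>

text \<open>The value is meaningful only if \<open>x\<close> and \<open>y\<close> are joined by a path.\<close>

definition graph_dist :: "'a pair_pre_digraph \<Rightarrow> 'a \<Rightarrow> 'a \<Rightarrow> nat" where
  "graph_dist G x y = (LEAST l. \<exists>p. pre_digraph.apath (with_proj G) x p y \<and> length p = l)"

definition k_metric_generator :: "nat \<Rightarrow> 'a pair_pre_digraph \<Rightarrow> 'a set \<Rightarrow> bool" where
  "k_metric_generator k G S \<longleftrightarrow> S \<subseteq> pverts G \<and>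
     (\<forall>u \<in> pverts G. \<forall>v \<in> pverts G. u \<noteq> v \<longrightarrow>
        k \<le> card {w \<in> S. graph_dist G u w \<noteq> graph_dist G v w})"

definition k_metric_dim :: "nat \<Rightarrow> 'a pair_pre_digraph \<Rightarrow> nat" where
  "k_metric_dim k G = (LEAST m. \<exists>S. k_metric_generator k G S \<and> card S = m)"

definition complement_graph :: "'a pair_pre_digraph \<Rightarrow> 'a pair_pre_digraph" where
  "complement_graph H = \<lparr> pverts = pverts H,
     parcs = {(x, y). x \<in> pverts H \<and> y \<in> pverts H \<and> x \<noteq> y \<and> (x, y) \<notin> parcs H} \<rparr>"

text \<open>The join \<open>K\<^sub>1 + H\<close>; the new vertex is \<open>None\<close>.\<close>

definition join_K1 :: "'a pair_pre_digraph \<Rightarrow> 'a option pair_pre_digraph" where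
  "join_K1 H = \<lparr> pverts = insert None (Some ` pverts H),
     parcs = {(Some x, Some y) | x y. (x, y) \<in> parcs H}
           \<union> {(None, Some x) | x. x \<in> pverts H}
           \<union> {(Some x, None) | x. x \<in> pverts H} \<rparr>"

text \<open>
  The corona product of \<open>G\<close> and \<open>H 1, \<dots>, H n\<close>, where \<open>v 1, \<dots>, v n\<close> enumerates the vertices
  of \<open>G\<close>. The copy of a vertex \<open>x\<close> of \<open>H i\<close> in the disjoint union is \<open>Inr (i, x)\<close>.
\<close>

definition corona ::
  "nat \<Rightarrow> (nat \<Rightarrow> 'a) \<Rightarrow> 'a pair_pre_digraph \<Rightarrow> (nat \<Rightarrow> 'b pair_pre_digraph)
     \<Rightarrow> ('a + nat \<times> 'b) pair_pre_digraph" where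
  "corona n v G H = \<lparr>
     pverts = Inl ` pverts G \<union> {Inr (i, x) | i x. i \<in> {1..n} \<and> x \<in> pverts (H i)},
     parcs = {(Inl x, Inl y) | x y. (x, y) \<in> parcs G}
           \<union> {(Inr (i, x), Inr (i, y)) | i x y. i \<in> {1..n} \<and> (x, y) \<in> parcs (H i)}
           \<union> {(Inl (v i), Inr (i, x)) | i x. i \<in> {1..n} \<and> x \<in> pverts (H i)}
           \<union> {(Inr (i, x), Inl (v i)) | i x. i \<in> {1..n} \<and> x \<in> pverts (H i)} \<rparr>"

definition is_path_graph :: "nat \<Rightarrow> 'a pair_pre_digraph \<Rightarrow> bool" where
  "is_path_graph m P \<longleftrightarrow> 0 < m \<and>
     (\<exists>xs. length xs = m \<and> distinct xs \<and> pverts P = set xs \<and>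
        parcs P = {(xs ! i, xs ! j) | i j. i < m \<and> j < m \<and> (j = Suc i \<or> i = Suc j)})"

end

theory Submission
  imports Defs
begin

text \<open>
  Inside a corona product, two vertices of the same copy \<open>H i\<close> are at distance at most 2, because
  both are adjacent to \<open>v i\<close>, and every vertex outside the copy is reached through \<open>v i\<close>, hence is
  equidistant from both. So such a pair can only be told apart by vertices of that copy, and there
  only by adjacency: \<open>w\<close> distinguishes \<open>x\<close> and \<open>y\<close> iff \<open>w\<close> is one of them or is adjacent to exactly
  one of them. All other pairs are distinguished by every vertex of some whole copy. The \<open>k\<close>-metric
  dimension of the corona is therefore the sum of the \<open>k\<close>-adjacency dimensions of the \<open>H i\<close>
  (\<open>k_metric_dim_corona\<close>), for every
  connected \<open>G\<close> with at least two vertices.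

  Exchanging adjacency and non-adjacency does not affect which pairs a vertex tells apart, so
  complements have the same adjacency dimension. In \<open>K\<^sub>1 + H\<close> the apex does not separate any two old
  vertices, so only the pairs (apex, \<open>x\<close>) are new; they are separated by the non-neighbours of \<open>x\<close>
  in the generator. If all degrees in \<open>H\<close> are at most \<open>D\<close> and the adjacency dimension is at least
  \<open>k + D\<close>, there are enough of them (\<open>k_adjacency_dim_join\<close>). For paths \<open>D = 2\<close>, and the
  assumptions on the orders make the dimension large enough.

  It remains to compute the adjacency dimension of a path with vertices \<open>0, \<dots>, m - 1\<close>.

  For \<open>k = 1\<close>, the vertices outside a generator \<open>S\<close> have pairwise different sets of neighbours in
  \<open>S\<close>. At most one of these sets is empty, at most \<open>card S\<close> are singletons, and their sizes add up to
  at most \<open>2 * card S\<close>; this gives \<open>2 * m \<le> 5 * card S + 2\<close> (\<open>k_adjacency_generator_1_card\<close>). The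
  bound is attained by two residue classes modulo 5.

  For \<open>k = 2\<close> and \<open>k = 3\<close>, the pairs at distance 1 and 2 give conditions on short windows:
  \<open>{i - 1, i, i + 1, i + 2}\<close> and \<open>{i - 1, i, i + 2, i + 3}\<close> both contain at least \<open>k\<close> elements of \<open>S\<close>
  (\<open>window_adjacent\<close>, \<open>window_gap\<close>). For \<open>k = 2\<close>, chaining disjoint windows shows that \<open>S\<close> contains
  more than half of the vertices, and the even numbers together with the last vertex suffice. For
  \<open>k = 3\<close>, the conditions say that the vertices missing from \<open>S\<close> are at least 4 away from both ends
  and at least 5 away from each other.
\<close>

section \<open>Shortest paths\<close>

context pair_wf_digraph
begin

text \<open>
  The distance is defined by paths without repeated vertices; a walk can be shortcut to such a path
  using only its own arcs, so walks may be used for upper bounds.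
\<close>

lemma graph_dist_le_walk:
  assumes "awalk u p w"
  shows "graph_dist G u w \<le> length p"
proof -
  let ?q = "awalk_to_apath p"
  have q: "apath u ?q w"
    using assms by (rule apath_awalk_to_apath)
  have "distinct ?q"
    using q distinct_verts_imp_distinct[of u ?q w] by (simp add: apath_def)
  hence "length ?q = card (set ?q)"
    by (simp add: distinct_card)
  also have "\<dots> \<le> card (set p)"
    using awalk_to_apath_subset[OF assms] by (simp add: card_mono)
  also have "\<dots> \<le> length p"
    by (rule card_length)
  finally have "length ?q \<le> length p" .
  moreover have "graph_dist G u w \<le> length ?q"
    unfolding graph_dist_def by (rule Least_le) (use q in blast)
  ultimately show ?thesis by simp
qed

lemma graph_dist_attained:
  assumes "u \<rightarrow>\<^sup>*\<^bsub>with_proj G\<^esub> w"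
  obtains p where "awalk u p w" "length p = graph_dist G u w"
proof -
  from assms[unfolded reachable_apath] obtain p where "apath u p w"
    by blast
  hence "\<exists>l p. apath u p w \<and> length p = l"
    by blast
  from LeastI_ex[OF this] have "\<exists>p. apath u p w \<and> length p = graph_dist G u w"
    unfolding graph_dist_def .
  thus ?thesis
    using that awalkI_apath by blast
qed

lemma graph_dist_refl:
  assumes "u \<in> pverts G"
  shows "graph_dist G u u = 0"
  using graph_dist_le_walk[of u "[]" u] assms by (simp add: awalk_Nil_iff)

lemma graph_dist_arc:
  assumes "(u, u') \<in> parcs G" "u' \<rightarrow>\<^sup>*\<^bsub>with_proj G\<^esub> w"
  shows "graph_dist G u w \<le> Suc (graph_dist G u' w)"
proof -
  obtain p where p: "awalk u' p w" "length p = graph_dist G u' w"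
    using assms(2) by (rule graph_dist_attained)
  have "awalk u ((u, u') # p) w"
    using p(1) assms(1) by (simp add: awalk_Cons_iff)
  from graph_dist_le_walk[OF this] p(2) show ?thesis
    by simp
qed

text \<open>
  Together with \<open>graph_dist_arc\<close> this recursion determines all distances that are needed below,
  without reference to explicit walks.
\<close>

lemma graph_dist_first_step:
  assumes "u \<rightarrow>\<^sup>*\<^bsub>with_proj G\<^esub> w" "u \<noteq> w"
  obtains u' where "(u, u') \<in> parcs G" "graph_dist G u w = Suc (graph_dist G u' w)"
proof -
  obtain p where p: "awalk u p w" "length p = graph_dist G u w"
    using assms(1) by (rule graph_dist_attained)
  obtain e es where es: "p = e # es"
    using p(1) assms(2) by (cases p) (auto simp: awalk_Nil_iff)
  have e: "e \<in> parcs G" "fst e = u" "awalk (snd e) es w"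
    using p(1) by (auto simp: es awalk_Cons_iff)
  have arc: "(u, snd e) \<in> parcs G"
    using e by (metis prod.collapse)
  have "graph_dist G (snd e) w \<le> length es"
    using e(3) by (rule graph_dist_le_walk)
  moreover have "graph_dist G u w \<le> Suc (graph_dist G (snd e) w)"
    using arc e(3) by (intro graph_dist_arc) (auto simp: reachable_awalk)
  ultimately have "graph_dist G u w = Suc (graph_dist G (snd e) w)"
    using p(2) es by simp
  with arc show ?thesis
    by (rule that)
qed

lemma graph_dist_eq_0_iff:
  assumes "u \<rightarrow>\<^sup>*\<^bsub>with_proj G\<^esub> w"
  shows "graph_dist G u w = 0 \<longleftrightarrow> u = w"
proof
  assume "graph_dist G u w = 0"
  thus "u = w"
    using graph_dist_first_step[OF assms] by (metis nat.distinct(1))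
next
  assume "u = w"
  thus "graph_dist G u w = 0"
    using graph_dist_refl reachable_in_verts(1)[OF assms] by simp
qed

lemma graph_dist_eq_1_iff:
  assumes "u \<rightarrow>\<^sup>*\<^bsub>with_proj G\<^esub> w" "u \<noteq> w"
  shows "graph_dist G u w = 1 \<longleftrightarrow> (u, w) \<in> parcs G"
proof
  assume one: "graph_dist G u w = 1"
  obtain p where p: "awalk u p w" "length p = 1"
    using graph_dist_attained[OF assms(1)] one by metis
  then obtain e where "p = [e]"
    by (cases p) auto
  with p(1) show "(u, w) \<in> parcs G"
    by (auto simp: awalk_Cons_iff awalk_Nil_iff)
next
  assume arc: "(u, w) \<in> parcs G"
  hence w: "w \<in> pverts G"
    by (rule in_arcsD2)
  have "graph_dist G u w \<le> Suc (graph_dist G w w)"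
    using arc w by (intro graph_dist_arc) simp_all
  moreover have "graph_dist G u w \<noteq> 0"
    using assms by (simp add: graph_dist_eq_0_iff)
  ultimately show "graph_dist G u w = 1"
    using graph_dist_refl[OF w] by simp
qed

end

section \<open>Adjacency generators\<close>

text \<open>
  In a graph of diameter at most 2 this says that \<open>x\<close> and \<open>y\<close> have different distances from \<open>w\<close>: the
  distances are 0, 1 or 2 according to equality and adjacency.
\<close>

definition resolves :: "'a pair_pre_digraph \<Rightarrow> 'a \<Rightarrow> 'a \<Rightarrow> 'a \<Rightarrow> bool" where
  "resolves H x y w \<longleftrightarrow> w = x \<or> w = y \<or> ((x, w) \<in> parcs H) \<noteq> ((y, w) \<in> parcs H)"

lemma resolves_commute: "resolves H x y w \<longleftrightarrow> resolves H y x w"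
  by (auto simp: resolves_def)

definition k_adjacency_generator :: "nat \<Rightarrow> 'a pair_pre_digraph \<Rightarrow> 'a set \<Rightarrow> bool" where
  "k_adjacency_generator k H S \<longleftrightarrow> S \<subseteq> pverts H \<and>
     (\<forall>x \<in> pverts H. \<forall>y \<in> pverts H. x \<noteq> y \<longrightarrow> k \<le> card {w \<in> S. resolves H x y w})"

definition k_adjacency_dim :: "nat \<Rightarrow> 'a pair_pre_digraph \<Rightarrow> nat" where
  "k_adjacency_dim k H = (LEAST s. \<exists>S. k_adjacency_generator k H S \<and> card S = s)"

lemma k_adjacency_dim_le: "k_adjacency_generator k H S \<Longrightarrow> k_adjacency_dim k H \<le> card S"
  unfolding k_adjacency_dim_def by (rule Least_le) blast

lemma k_adjacency_basis:
  assumes "k_adjacency_generator k H S"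
  obtains B where "k_adjacency_generator k H B" "card B = k_adjacency_dim k H"
proof -
  have "\<exists>s B. k_adjacency_generator k H B \<and> card B = s"
    using assms by blast
  from LeastI_ex[OF this] have "\<exists>B. k_adjacency_generator k H B \<and> card B = k_adjacency_dim k H"
    unfolding k_adjacency_dim_def .
  thus ?thesis
    using that by blast
qed

lemma k_adjacency_dim_eqI:
  assumes "k_adjacency_generator k H S" "card S = s"
    and "\<And>T. k_adjacency_generator k H T \<Longrightarrow> s \<le> card T"
  shows "k_adjacency_dim k H = s"
  unfolding k_adjacency_dim_def using assms by (intro Least_equality) blast+

lemma k_metric_dim_eqI:
  assumes "k_metric_generator k H S" "card S = s"
    and "\<And>T. k_metric_generator k H T \<Longrightarrow> s \<le> card T"
  shows "k_metric_dim k H = s"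
  unfolding k_metric_dim_def using assms by (intro Least_equality) blast+

lemma k_adjacency_generator_iso:
  assumes bij: "bij_betw f (pverts H) (pverts H')"
    and arcs: "\<And>x y. x \<in> pverts H \<Longrightarrow> y \<in> pverts H \<Longrightarrow> (f x, f y) \<in> parcs H' \<longleftrightarrow> (x, y) \<in> parcs H"
    and gen: "k_adjacency_generator k H S"
  shows "k_adjacency_generator k H' (f ` S)" and "card (f ` S) = card S"
proof -
  have S: "S \<subseteq> pverts H"
    using gen by (simp add: k_adjacency_generator_def)
  have inj: "inj_on f (pverts H)" and img: "pverts H' = f ` pverts H"
    using bij by (auto simp: bij_betw_def)
  show "card (f ` S) = card S"
    using inj S by (intro card_image) (rule inj_on_subset)
  have res: "resolves H' (f x) (f y) (f w) \<longleftrightarrow> resolves H x y w"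
    if "x \<in> pverts H" "y \<in> pverts H" "w \<in> pverts H" for x y w
    using that arcs inj_on_eq_iff[OF inj] by (simp add: resolves_def)
  have "k \<le> card {w \<in> f ` S. resolves H' (f x) (f y) w}"
    if xy: "x \<in> pverts H" "y \<in> pverts H" "f x \<noteq> f y" for x y
  proof -
    have "x \<noteq> y"
      using xy(3) by blast
    hence "k \<le> card {w \<in> S. resolves H x y w}"
      using gen xy unfolding k_adjacency_generator_def by blast
    also have "\<dots> = card (f ` {w \<in> S. resolves H x y w})"
      using inj S by (intro card_image[symmetric]) (auto intro: inj_on_subset)
    also have "f ` {w \<in> S. resolves H x y w} = {w \<in> f ` S. resolves H' (f x) (f y) w}"
      using res xy S by blast
    finally show ?thesis .
  qed
  thus "k_adjacency_generator k H' (f ` S)"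
    using S unfolding k_adjacency_generator_def img by blast
qed

lemma k_adjacency_dim_iso:
  assumes bij: "bij_betw f (pverts H) (pverts H')"
    and arcs: "\<And>x y. x \<in> pverts H \<Longrightarrow> y \<in> pverts H \<Longrightarrow> (f x, f y) \<in> parcs H' \<longleftrightarrow> (x, y) \<in> parcs H"
    and gen: "k_adjacency_generator k H S"
  shows "k_adjacency_dim k H' = k_adjacency_dim k H"
proof -
  obtain B where B: "k_adjacency_generator k H B" "card B = k_adjacency_dim k H"
    using gen by (rule k_adjacency_basis)
  define g where "g = inv_into (pverts H) f"
  have bij': "bij_betw g (pverts H') (pverts H)"
    unfolding g_def using bij by (rule bij_betw_inv_into)
  have fg: "g y \<in> pverts H" "f (g y) = y" if "y \<in> pverts H'" for y
    using that bij bij' unfolding g_def by (auto simp: bij_betw_inv_into_right bij_betwE)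
  have arcs': "(g x, g y) \<in> parcs H \<longleftrightarrow> (x, y) \<in> parcs H'"
    if "x \<in> pverts H'" "y \<in> pverts H'" for x y
    using arcs[of "g x" "g y"] fg that by simp
  show ?thesis
  proof (rule k_adjacency_dim_eqI)
    show "k_adjacency_generator k H' (f ` B)" "card (f ` B) = k_adjacency_dim k H"
      using k_adjacency_generator_iso[OF bij arcs B(1)] B(2) by simp_all
    fix T assume "k_adjacency_generator k H' T"
    note T = k_adjacency_generator_iso[OF bij' arcs' this]
    show "k_adjacency_dim k H \<le> card T"
      using k_adjacency_dim_le[OF T(1)] T(2) by simp
  qed
qed

section \<open>Simple graphs\<close>

text \<open>
  The arc relation is automatically finite when the vertex set is, which leaves only the properties
  of a single arc to be checked.
\<close>

lemma pair_graphI: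
  assumes "finite (pverts H)"
    and "\<And>x y. (x, y) \<in> parcs H \<Longrightarrow> x \<in> pverts H \<and> y \<in> pverts H \<and> x \<noteq> y \<and> (y, x) \<in> parcs H"
  shows "pair_graph H"
proof -
  have "finite (parcs H)"
    by (rule finite_subset[of _ "pverts H \<times> pverts H"]) (use assms in auto)
  moreover have "symmetric (with_proj H)"
    using assms(2) by (auto simp: symmetric_def intro: symI)
  ultimately show ?thesis
    using assms by unfold_locales (auto simp: surj_pair)
qed

lemma pair_graph_arcD:
  assumes "pair_graph H" "(x, y) \<in> parcs H"
  shows "x \<in> pverts H" "y \<in> pverts H" "x \<noteq> y" "(y, x) \<in> parcs H"
proof -
  interpret pair_graph H by (rule assms(1))
  show "x \<in> pverts H" "y \<in> pverts H" "x \<noteq> y" "(y, x) \<in> parcs H"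
    using assms(2) in_arcsD1 in_arcsD2 no_loops' arcs_symmetric by blast+
qed

lemma pair_graph_finite: "pair_graph H \<Longrightarrow> finite (pverts H)"
  using pair_fin_digraph.pair_finite_verts pair_graph_def pair_digraph_def by blast

section \<open>The metric dimension of corona products\<close>

locale corona_product = G: pair_graph G
  for G :: "'a pair_pre_digraph" +
  fixes n :: nat and v :: "nat \<Rightarrow> 'a" and H :: "nat \<Rightarrow> 'b pair_pre_digraph"
  assumes connected_G: "Digraph_Component.connected (with_proj G)"
    and two_le_n: "2 \<le> n"
    and bij_v: "bij_betw v {1..n} (pverts G)"
    and graph_H: "i \<in> {1..n} \<Longrightarrow> pair_graph (H i)"
begin

abbreviation C :: "('a + nat \<times> 'b) pair_pre_digraph" where
  "C \<equiv> corona n v G H"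

abbreviation d :: "'a + nat \<times> 'b \<Rightarrow> 'a + nat \<times> 'b \<Rightarrow> nat" where
  "d \<equiv> graph_dist C"

definition block :: "nat \<Rightarrow> ('a + nat \<times> 'b) set" where
  "block i = (\<lambda>x. Inr (i, x)) ` pverts (H i)"

lemma v_in_G: "i \<in> {1..n} \<Longrightarrow> v i \<in> pverts G"
  using bij_v by (auto simp: bij_betw_def)

lemma v_eq_iff: "i \<in> {1..n} \<Longrightarrow> j \<in> {1..n} \<Longrightarrow> v i = v j \<longleftrightarrow> i = j"
  using inj_on_eq_iff[OF bij_betw_imp_inj_on[OF bij_v]] by blast

lemma pverts_C: "pverts C = Inl ` v ` {1..n} \<union> (\<Union>i\<in>{1..n}. block i)"
  using bij_v by (auto simp: corona_def block_def bij_betw_def)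

lemma Inr_in_C: "Inr (i, x) \<in> pverts C \<longleftrightarrow> i \<in> {1..n} \<and> x \<in> pverts (H i)"
  by (auto simp: corona_def)

lemma Inl_in_C: "Inl a \<in> pverts C \<longleftrightarrow> a \<in> pverts G"
  by (auto simp: corona_def)

lemma arc_Inl_Inl: "(Inl a, Inl b) \<in> parcs C \<longleftrightarrow> (a, b) \<in> parcs G"
  by (auto simp: corona_def)

lemma arc_Inl_Inr:
  "(Inl a, Inr (i, x)) \<in> parcs C \<longleftrightarrow> i \<in> {1..n} \<and> x \<in> pverts (H i) \<and> a = v i"
  by (auto simp: corona_def)

lemma arc_Inr_Inl:
  "(Inr (i, x), Inl a) \<in> parcs C \<longleftrightarrow> i \<in> {1..n} \<and> x \<in> pverts (H i) \<and> a = v i"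
  by (auto simp: corona_def)

lemma arc_Inr_Inr:
  "(Inr (i, x), Inr (j, y)) \<in> parcs C \<longleftrightarrow> i \<in> {1..n} \<and> j = i \<and> (x, y) \<in> parcs (H i)"
  by (auto simp: corona_def)

lemmas arc_C = arc_Inl_Inl arc_Inl_Inr arc_Inr_Inl arc_Inr_Inr

sublocale C: pair_wf_digraph C
proof
  have "a \<in> pverts C \<and> b \<in> pverts C" if "(a, b) \<in> parcs C" for a b
  proof -
    have "x \<in> pverts (H i) \<and> y \<in> pverts (H i)" if "i \<in> {1..n}" "(x, y) \<in> parcs (H i)" for i x y
    proof -
      interpret Hi: pair_graph "H i"
        using that by (intro graph_H)
      show ?thesis
        using that(2) Hi.in_arcsD1 Hi.in_arcsD2 by blast
    qed
    with that show ?thesis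
      by (cases a; cases b)
        (auto simp: arc_C Inr_in_C Inl_in_C v_in_G dest: G.in_arcsD1 G.in_arcsD2)
  qed
  thus "fst e \<in> pverts C" "snd e \<in> pverts C" if "e \<in> parcs C" for e
    using that by (metis prod.collapse)+
qed

lemma finite_pverts_H: "i \<in> {1..n} \<Longrightarrow> finite (pverts (H i))"
  using graph_H by (rule pair_graph_finite)

lemma finite_block: "i \<in> {1..n} \<Longrightarrow> finite (block i)"
  by (simp add: block_def finite_pverts_H)

lemma finite_pverts_C: "finite (pverts C)"
  by (simp add: pverts_C finite_block)

lemma reachable_C:
  assumes "u \<in> pverts C" "w \<in> pverts C"
  shows "u \<rightarrow>\<^sup>*\<^bsub>with_proj C\<^esub> w"
proof -
  have sc: "strongly_connected (with_proj G)"
    by (rule G.symmetric_connected_imp_strongly_connected) (rule G.pair_sym_arcs, rule connected_G)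
  have lift: "Inl a \<rightarrow>\<^sup>*\<^bsub>with_proj C\<^esub> Inl b" if "a \<rightarrow>\<^sup>*\<^bsub>with_proj G\<^esub> b" for a b
    using that
  proof (induction rule: G.reachable_induct)
    case base
    thus ?case by (simp add: Inl_in_C)
  next
    case (step x y)
    have "(Inl x, Inl y) \<in> parcs C"
      using step by (simp add: arc_C)
    with step.IH show ?case
      by (metis C.reachable_adj_trans)
  qed
  have base: "Inl a \<rightarrow>\<^sup>*\<^bsub>with_proj C\<^esub> Inl b" if "a \<in> pverts G" "b \<in> pverts G" for a b
    using sc that by (intro lift) (auto simp: strongly_connected_def)
  have to: "\<exists>a\<in>pverts G. u \<rightarrow>\<^sup>*\<^bsub>with_proj C\<^esub> Inl a" if "u \<in> pverts C" for u
  proof (cases u)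
    case (Inl a)
    thus ?thesis using that by (metis Inl_in_C C.reachable_refl)
  next
    case (Inr ix)
    obtain i x where "ix = (i, x)" by (cases ix)
    with that Inr have "(u, Inl (v i)) \<in> parcs C" "i \<in> {1..n}"
      by (auto simp: arc_C Inr_in_C)
    thus ?thesis using v_in_G by (metis C.reachable_adjI)
  qed
  have "\<exists>a\<in>pverts G. Inl a \<rightarrow>\<^sup>*\<^bsub>with_proj C\<^esub> u" if "u \<in> pverts C" for u
  proof (cases u)
    case (Inl a)
    thus ?thesis using that by (metis Inl_in_C C.reachable_refl)
  next
    case (Inr ix)
    obtain i x where "ix = (i, x)" by (cases ix)
    with that Inr have "(Inl (v i), u) \<in> parcs C" "i \<in> {1..n}"
      by (auto simp: arc_C Inr_in_C)
    thus ?thesis using v_in_G by (metis C.reachable_adjI)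
  qed
  with to base assms show ?thesis
    by (meson C.reachable_trans)
qed

text \<open>
  The first step of a shortest path either stays in the block, where the remaining distance is
  smaller and the claim holds by induction, or goes to \<open>v i\<close>.
\<close>

lemma dist_leaving_block:
  assumes "i \<in> {1..n}" "x \<in> pverts (H i)" "w \<in> pverts C" "w \<notin> block i"
  shows "d (Inr (i, x)) w = Suc (d (Inl (v i)) w)"
proof (rule antisym)
  have "(Inr (i, x), Inl (v i)) \<in> parcs C"
    using assms by (simp add: arc_C)
  thus "d (Inr (i, x)) w \<le> Suc (d (Inl (v i)) w)"
    using assms by (intro C.graph_dist_arc reachable_C) (auto simp: Inl_in_C v_in_G)
next
  show "Suc (d (Inl (v i)) w) \<le> d (Inr (i, x)) w"
    using assms(2)
  proof (induction "d (Inr (i, x)) w" arbitrary: x rule: less_induct)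
    case (less x)
    have ne: "Inr (i, x) \<noteq> w"
      using assms less.prems by (auto simp: block_def)
    have r: "Inr (i, x) \<rightarrow>\<^sup>*\<^bsub>with_proj C\<^esub> w"
      using assms less.prems by (intro reachable_C) (auto simp: Inr_in_C)
    obtain u where u: "(Inr (i, x), u) \<in> parcs C" "d (Inr (i, x)) w = Suc (d u w)"
      using r ne by (rule C.graph_dist_first_step)
    show ?case
    proof (cases u)
      case (Inl a)
      with u show ?thesis by (simp add: arc_C)
    next
      case (Inr jy)
      obtain j y where jy: "jy = (j, y)" by (cases jy)
      have "u \<in> pverts C"
        using u(1) by (rule C.in_arcsD2)
      hence "u = Inr (i, y)" "y \<in> pverts (H i)"
        using u(1) Inr jy by (auto simp: arc_C Inr_in_C)
      thus ?thesis
        using less.hyps[of y] u(2) by simp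
    qed
  qed
qed

lemma dist_inside_block:
  assumes "i \<in> {1..n}" "x \<in> pverts (H i)" "w \<in> pverts (H i)"
  shows "d (Inr (i, x)) (Inr (i, w)) = (if x = w then 0 else if (x, w) \<in> parcs (H i) then 1 else 2)"
proof -
  let ?x = "Inr (i, x) :: 'a + nat \<times> 'b" and ?w = "Inr (i, w) :: 'a + nat \<times> 'b"
  have r: "?x \<rightarrow>\<^sup>*\<^bsub>with_proj C\<^esub> ?w"
    using assms by (intro reachable_C) (auto simp: Inr_in_C)
  have r': "Inl (v i) \<rightarrow>\<^sup>*\<^bsub>with_proj C\<^esub> ?w"
    using assms by (intro reachable_C) (auto simp: Inr_in_C Inl_in_C v_in_G)
  have "d (Inl (v i)) ?w = 1"
    using r' assms by (subst C.graph_dist_eq_1_iff) (auto simp: arc_C)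
  moreover have "d ?x ?w \<le> Suc (d (Inl (v i)) ?w)"
    using assms r' by (intro C.graph_dist_arc) (auto simp: arc_C)
  ultimately have "d ?x ?w \<le> 2"
    by simp
  moreover have "d ?x ?w = 0 \<longleftrightarrow> x = w"
    using C.graph_dist_eq_0_iff[OF r] by simp
  moreover have "x \<noteq> w \<Longrightarrow> d ?x ?w = 1 \<longleftrightarrow> (x, w) \<in> parcs (H i)"
    using C.graph_dist_eq_1_iff[OF r] assms by (simp add: arc_C)
  ultimately show ?thesis
    by auto
qed

lemma dist_resolves_iff:
  assumes "i \<in> {1..n}" "x \<in> pverts (H i)" "y \<in> pverts (H i)" "x \<noteq> y" "w \<in> pverts (H i)"
  shows "d (Inr (i, x)) (Inr (i, w)) \<noteq> d (Inr (i, y)) (Inr (i, w)) \<longleftrightarrow> resolves (H i) x y w"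
proof -
  interpret Hi: pair_graph "H i"
    using assms(1) by (rule graph_H)
  show ?thesis
    using assms by (auto simp: dist_inside_block resolves_def)
qed

lemma dist_centre_1:
  assumes "i \<in> {1..n}" "w \<in> block i"
  shows "d (Inl (v i)) w = 1"
  using assms by (subst C.graph_dist_eq_1_iff)
    (auto simp: arc_C block_def Inr_in_C Inl_in_C v_in_G intro!: reachable_C)

lemma dist_other_centre:
  assumes "i \<in> {1..n}" "j \<in> {1..n}" "i \<noteq> j" "w \<in> block i"
  shows "2 \<le> d (Inl (v j)) w"
proof -
  obtain z where z: "w = Inr (i, z)" "z \<in> pverts (H i)"
    using assms(4) by (auto simp: block_def)
  have r: "Inl (v j) \<rightarrow>\<^sup>*\<^bsub>with_proj C\<^esub> w"
    using assms z by (intro reachable_C) (auto simp: Inr_in_C Inl_in_C v_in_G)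
  have "d (Inl (v j)) w \<noteq> 0"
    using C.graph_dist_eq_0_iff[OF r] z by simp
  moreover have "d (Inl (v j)) w \<noteq> 1"
    using C.graph_dist_eq_1_iff[OF r] z assms by (auto simp: arc_C v_eq_iff)
  ultimately show ?thesis by simp
qed

lemma dist_other_block:
  assumes "i \<in> {1..n}" "j \<in> {1..n}" "i \<noteq> j" "w \<in> block i" "u \<in> block j"
  shows "3 \<le> d u w"
proof -
  obtain y where y: "u = Inr (j, y)" "y \<in> pverts (H j)"
    using assms(5) by (auto simp: block_def)
  have w: "w \<in> pverts C" "w \<notin> block j"
    using assms by (auto simp: block_def Inr_in_C)
  show ?thesis
    using dist_other_centre[OF assms(1-4)] dist_leaving_block[OF assms(2) y(2) w] y by simp
qed

lemma dist_same_block: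
  assumes "i \<in> {1..n}" "w \<in> block i" "u \<in> block i"
  shows "d u w \<le> 2"
  using assms by (auto simp: block_def dist_inside_block)

text \<open>
  Two vertices outside a common block are distinguished by a whole block. For two vertices of \<open>G\<close>
  it is the block attached to one of them. For vertices of different blocks it is the block of the
  first one (distance at most 2 against at least 3). For \<open>v j\<close> and a vertex of another block it is
  the block of \<open>v j\<close>. For \<open>v i\<close> and a vertex of its own block it is any other block, which exists
  because \<open>n \<ge> 2\<close>: paths to it run through \<open>v i\<close>.
\<close>

lemma blocks_separate:
  assumes "u \<in> pverts C" "u' \<in> pverts C" "u \<noteq> u'"
    and "\<And>j. j \<in> {1..n} \<Longrightarrow> \<not> (u \<in> block j \<and> u' \<in> block j)"
  obtains i where "i \<in> {1..n}" "\<And>w. w \<in> block i \<Longrightarrow> d u w \<noteq> d u' w"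
proof -
  define good where "good u u' \<longleftrightarrow> (\<exists>i\<in>{1..n}. \<forall>w\<in>block i. d u w \<noteq> d u' w)" for u u'
  have good_sym: "good u u'" if "good u' u" for u u'
    using that unfolding good_def by metis
  have centres: "good (Inl (v i)) (Inl (v j))" if "i \<in> {1..n}" "j \<in> {1..n}" "i \<noteq> j" for i j
    using that dist_centre_1 dist_other_centre[OF that] unfolding good_def
    by (intro bexI[of _ i]) fastforce+
  have mixed: "good (Inl (v j)) u" if "i \<in> {1..n}" "j \<in> {1..n}" "u \<in> block i" for i j u
  proof (cases "i = j")
    case False
    have "\<forall>w\<in>block j. d (Inl (v j)) w \<noteq> d u w"
      using that False dist_centre_1[of j] dist_other_block[of j i _ u] by fastforce
    thus ?thesis
      unfolding good_def using that by blast
  next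
    case True
    \<comment> \<open>Any index other than \<open>i\<close> will do.\<close>
    define j' where "j' = (if i = 1 then 2 else 1 :: nat)"
    have j': "j' \<in> {1..n}" "j' \<noteq> i"
      using two_le_n by (auto simp: j'_def)
    obtain x where x: "u = Inr (i, x)" "x \<in> pverts (H i)"
      using \<open>u \<in> block i\<close> by (auto simp: block_def)
    have "d u w = Suc (d (Inl (v i)) w)" if w: "w \<in> block j'" for w
    proof -
      have "w \<in> pverts C" "w \<notin> block i"
        using w j' by (auto simp: block_def Inr_in_C)
      thus ?thesis
        using x \<open>i \<in> {1..n}\<close> by (simp add: dist_leaving_block)
    qed
    thus ?thesis
      unfolding good_def using j' True by (intro bexI[of _ j']) auto
  qed
  have "good u u'"
  proof (cases "u \<in> Inl ` v ` {1..n}")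
    case u: True
    show ?thesis
    proof (cases "u' \<in> Inl ` v ` {1..n}")
      case True
      with u obtain i j where "i \<in> {1..n}" "j \<in> {1..n}" "u = Inl (v i)" "u' = Inl (v j)"
        by blast
      with assms(3) show ?thesis
        using centres[of i j] by blast
    next
      case False
      with assms(2) obtain i where "i \<in> {1..n}" "u' \<in> block i"
        by (auto simp: pverts_C)
      with u show ?thesis using mixed by blast
    qed
  next
    case u: False
    with assms(1) obtain i where i: "i \<in> {1..n}" "u \<in> block i"
      by (auto simp: pverts_C)
    show ?thesis
    proof (cases "u' \<in> Inl ` v ` {1..n}")
      case True
      with i show ?thesis using mixed good_sym by blast
    next
      case False
      with assms(2) obtain j where j: "j \<in> {1..n}" "u' \<in> block j"
        by (auto simp: pverts_C)
      have "i \<noteq> j"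
        using i j assms(4) by blast
      have "d u w \<noteq> d u' w" if "w \<in> block i" for w
        using dist_same_block[OF i(1) that i(2)] dist_other_block[OF i(1) j(1) \<open>i \<noteq> j\<close> that j(2)]
        by simp
      thus ?thesis
        unfolding good_def using i by blast
    qed
  qed
  thus ?thesis
    using that unfolding good_def by blast
qed

text \<open>
  Vertices outside the block are equidistant from \<open>x\<close> and \<open>y\<close>, so only the part of \<open>S\<close> in this block
  counts.
\<close>

lemma card_resolving_in_block:
  assumes "i \<in> {1..n}" "x \<in> pverts (H i)" "y \<in> pverts (H i)" "x \<noteq> y" "S \<subseteq> pverts C"
  shows "card {w \<in> S. d (Inr (i, x)) w \<noteq> d (Inr (i, y)) w}
    = card {w. Inr (i, w) \<in> S \<and> resolves (H i) x y w}"
proof -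
  have "{w \<in> S. d (Inr (i, x)) w \<noteq> d (Inr (i, y)) w}
    = (\<lambda>w. Inr (i, w)) ` {w. Inr (i, w) \<in> S \<and> resolves (H i) x y w}" (is "?L = ?R")
  proof
    show "?L \<subseteq> ?R"
    proof
      fix w assume w: "w \<in> ?L"
      hence "w \<in> pverts C" using assms by auto
      have "w \<in> block i"
      proof (rule ccontr)
        assume "w \<notin> block i"
        with w \<open>w \<in> pverts C\<close> assms dist_leaving_block show False by simp
      qed
      then obtain z where "w = Inr (i, z)" "z \<in> pverts (H i)"
        by (auto simp: block_def)
      with w assms show "w \<in> ?R"
        by (auto simp: dist_resolves_iff)
    qed
    show "?R \<subseteq> ?L"
    proof
      fix w assume "w \<in> ?R"
      then obtain z where z: "w = Inr (i, z)" "Inr (i, z) \<in> S" "resolves (H i) x y z"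
        by blast
      hence "z \<in> pverts (H i)"
        using assms(5) Inr_in_C by blast
      with z assms show "w \<in> ?L"
        by (simp add: dist_resolves_iff)
    qed
  qed
  thus ?thesis
    by (simp add: card_image inj_on_def)
qed

lemma k_metric_generator_block:
  assumes "k_metric_generator k C S" "i \<in> {1..n}"
  shows "k_adjacency_generator k (H i) {w. Inr (i, w) \<in> S}"
  unfolding k_adjacency_generator_def
proof (intro conjI ballI impI)
  have S: "S \<subseteq> pverts C"
    using assms by (simp add: k_metric_generator_def)
  thus "{w. Inr (i, w) \<in> S} \<subseteq> pverts (H i)"
    using Inr_in_C by blast
  fix x y assume xy: "x \<in> pverts (H i)" "y \<in> pverts (H i)" "x \<noteq> y"
  have "k \<le> card {w \<in> S. d (Inr (i, x)) w \<noteq> d (Inr (i, y)) w}"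
    using assms xy unfolding k_metric_generator_def by (simp add: Inr_in_C)
  also have "\<dots> = card {w. Inr (i, w) \<in> S \<and> resolves (H i) x y w}"
    using assms(2) xy S by (rule card_resolving_in_block)
  finally show "k \<le> card {w \<in> {w. Inr (i, w) \<in> S}. resolves (H i) x y w}"
    by simp
qed

lemma card_blocks:
  assumes "\<And>i. i \<in> {1..n} \<Longrightarrow> B i \<subseteq> pverts (H i)"
  shows "card (\<Union>i\<in>{1..n}. (\<lambda>x. Inr (i, x) :: 'a + nat \<times> 'b) ` B i) = (\<Sum>i=1..n. card (B i))"
proof -
  have fin: "finite (B i)" if "i \<in> {1..n}" for i
    using assms[OF that] finite_pverts_H[OF that] by (rule finite_subset)
  have "card (\<Union>i\<in>{1..n}. (\<lambda>x. Inr (i, x) :: 'a + nat \<times> 'b) ` B i)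
      = (\<Sum>i=1..n. card ((\<lambda>x. Inr (i, x) :: 'a + nat \<times> 'b) ` B i))"
    using fin by (intro card_UN_disjoint) auto
  also have "\<dots> = (\<Sum>i=1..n. card (B i))"
    by (intro sum.cong refl card_image) (simp add: inj_on_def)
  finally show ?thesis .
qed

text \<open>
  Generators of the corona restrict to adjacency generators of the copies, and conversely the union
  of adjacency generators is a generator. A pair outside a common block is distinguished by at least
  \<open>k\<close> vertices because each adjacency generator already contains \<open>k\<close> vertices that resolve some
  pair; for this the copies need two vertices.
\<close>

theorem k_metric_dim_corona:
  assumes gen: "\<And>i. i \<in> {1..n} \<Longrightarrow> \<exists>S. k_adjacency_generator k (H i) S"
    and two: "\<And>i. i \<in> {1..n} \<Longrightarrow> 2 \<le> card (pverts (H i))"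
  shows "k_metric_dim k C = (\<Sum>i=1..n. k_adjacency_dim k (H i))"
proof -
  have "\<forall>i\<in>{1..n}. \<exists>B. k_adjacency_generator k (H i) B \<and> card B = k_adjacency_dim k (H i)"
    using gen k_adjacency_basis by metis
  then obtain B where B: "\<And>i. i \<in> {1..n} \<Longrightarrow> k_adjacency_generator k (H i) (B i)"
    "\<And>i. i \<in> {1..n} \<Longrightarrow> card (B i) = k_adjacency_dim k (H i)"
    by metis
  have sub: "B i \<subseteq> pverts (H i)" if "i \<in> {1..n}" for i
    using B(1)[OF that] by (simp add: k_adjacency_generator_def)
  define S where "S = (\<Union>i\<in>{1..n}. (\<lambda>x. Inr (i, x) :: 'a + nat \<times> 'b) ` B i)"
  have S_C: "S \<subseteq> pverts C"
  proof
    fix w assume "w \<in> S"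
    then obtain i x where "i \<in> {1..n}" "x \<in> B i" "w = Inr (i, x)"
      unfolding S_def by blast
    thus "w \<in> pverts C"
      using sub[of i] by (auto simp: Inr_in_C)
  qed
  have fin_S: "finite S"
    using S_C finite_pverts_C by (rule finite_subset)
  have in_S: "Inr (i, x) \<in> S \<longleftrightarrow> x \<in> B i" if "i \<in> {1..n}" for i x
    using that by (auto simp: S_def)
  have k_le: "k \<le> card (B i)" if i: "i \<in> {1..n}" for i
  proof -
    obtain x y where xy: "x \<in> pverts (H i)" "y \<in> pverts (H i)" "x \<noteq> y"
      using two[OF i] by (metis card_le_Suc0_iff_eq finite_pverts_H[OF i] not_less_eq_eq numeral_2_eq_2)
    have "k \<le> card {w \<in> B i. resolves (H i) x y w}"
      using B(1)[OF i] xy unfolding k_adjacency_generator_def by blast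
    also have "\<dots> \<le> card (B i)"
      using sub[OF i] finite_pverts_H[OF i] by (intro card_mono) (auto intro: finite_subset)
    finally show ?thesis .
  qed
  show ?thesis
  proof (rule k_metric_dim_eqI)
    show "k_metric_generator k C S"
      unfolding k_metric_generator_def
    proof (intro conjI ballI impI)
      fix u u' assume u: "u \<in> pverts C" "u' \<in> pverts C" "u \<noteq> u'"
      show "k \<le> card {w \<in> S. d u w \<noteq> d u' w}"
      proof (cases "\<exists>j\<in>{1..n}. u \<in> block j \<and> u' \<in> block j")
        case True
        then obtain i where i: "i \<in> {1..n}" and "u \<in> block i" "u' \<in> block i"
          by blast
        then obtain x y where
          xy: "u = Inr (i, x)" "u' = Inr (i, y)" "x \<in> pverts (H i)" "y \<in> pverts (H i)"
          by (auto simp: block_def)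
        have ne: "x \<noteq> y"
          using u(3) xy by blast
        have "k \<le> card {w \<in> B i. resolves (H i) x y w}"
          using B(1)[OF i] xy ne unfolding k_adjacency_generator_def by blast
        also have "\<dots> = card {w. Inr (i, w) \<in> S \<and> resolves (H i) x y w}"
          using in_S[OF i] by simp
        also have "\<dots> = card {w \<in> S. d u w \<noteq> d u' w}"
          using card_resolving_in_block[OF i xy(3,4) ne S_C] xy(1,2) by simp
        finally show ?thesis .
      next
        case False
        with u obtain i where i: "i \<in> {1..n}" "\<And>w. w \<in> block i \<Longrightarrow> d u w \<noteq> d u' w"
          using blocks_separate by blast
        have "k \<le> card (B i)"
          using i(1) by (rule k_le)
        also have "\<dots> = card ((\<lambda>x. Inr (i, x) :: 'a + nat \<times> 'b) ` B i)"
          by (simp add: card_image inj_on_def)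
        also have "\<dots> \<le> card {w \<in> S. d u w \<noteq> d u' w}"
          using i sub[OF i(1)] fin_S by (intro card_mono) (auto simp: S_def block_def)
        finally show ?thesis .
      qed
    qed (rule S_C)
    show "card S = (\<Sum>i=1..n. k_adjacency_dim k (H i))"
      using card_blocks[of B] sub B(2) by (simp add: S_def)
  next
    fix T assume T: "k_metric_generator k C T"
    let ?T = "\<lambda>i. {w. Inr (i, w) \<in> T}"
    have T_C: "T \<subseteq> pverts C"
      using T by (simp add: k_metric_generator_def)
    have gen_T: "k_adjacency_generator k (H i) (?T i)" if "i \<in> {1..n}" for i
      using T that by (rule k_metric_generator_block)
    have "(\<Sum>i=1..n. k_adjacency_dim k (H i)) \<le> (\<Sum>i=1..n. card (?T i))"
      using gen_T by (intro sum_mono k_adjacency_dim_le)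
    also have "\<dots> = card (\<Union>i\<in>{1..n}. (\<lambda>x. Inr (i, x) :: 'a + nat \<times> 'b) ` ?T i)"
      using gen_T by (intro card_blocks[symmetric]) (simp add: k_adjacency_generator_def)
    also have "\<dots> \<le> card T"
      using T_C finite_pverts_C by (intro card_mono) (auto intro: finite_subset)
    finally show "(\<Sum>i=1..n. k_adjacency_dim k (H i)) \<le> card T" .
  qed
qed

end

section \<open>Complements and joins with a single vertex\<close>

lemma pair_graph_complement:
  assumes "pair_graph H"
  shows "pair_graph (complement_graph H)"
  using pair_graph_finite[OF assms]
  by (intro pair_graphI) (auto simp: complement_graph_def dest: pair_graph_arcD[OF assms])

lemma pair_graph_join:
  assumes "pair_graph H"
  shows "pair_graph (join_K1 H)"
  using pair_graph_finite[OF assms]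
  by (intro pair_graphI) (auto simp: join_K1_def dest: pair_graph_arcD[OF assms])

lemma pverts_complement: "pverts (complement_graph H) = pverts H"
  by (simp add: complement_graph_def)

text \<open>
  The condition \<open>(x, w) \<in> E \<longleftrightarrow> (y, w) \<notin> E\<close> is invariant under complementing both sides.
  Complementing creates no loops, so the cases \<open>w = x\<close> and \<open>w = y\<close> are the exception, but there \<open>w\<close>
  resolves the pair in both graphs.
\<close>

lemma k_adjacency_generator_complement:
  "k_adjacency_generator k (complement_graph H) S \<longleftrightarrow> k_adjacency_generator k H S"
proof (cases "S \<subseteq> pverts H")
  case True
  have "{w \<in> S. resolves (complement_graph H) x y w} = {w \<in> S. resolves H x y w}"
    if "x \<in> pverts H" "y \<in> pverts H" for x y
    using that True by (auto simp: resolves_def complement_graph_def)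
  thus ?thesis
    by (simp add: k_adjacency_generator_def pverts_complement)
qed (auto simp: k_adjacency_generator_def complement_graph_def)

lemma k_adjacency_dim_complement:
  "k_adjacency_dim k (complement_graph H) = k_adjacency_dim k H"
  by (simp add: k_adjacency_dim_def k_adjacency_generator_complement)

lemma pverts_join: "pverts (join_K1 H) = insert None (Some ` pverts H)"
  by (simp add: join_K1_def)

lemma resolves_join_Some:
  "resolves (join_K1 H) (Some x) (Some y) (Some w) \<longleftrightarrow> resolves H x y w"
  by (auto simp: resolves_def join_K1_def)

lemma not_resolves_join_None:
  assumes "x \<in> pverts H" "y \<in> pverts H"
  shows "\<not> resolves (join_K1 H) (Some x) (Some y) None"
  using assms by (auto simp: resolves_def join_K1_def)

text \<open>
  The apex is adjacent to all old vertices and hence can be dropped from a generator.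
\<close>

lemma k_adjacency_generator_of_join:
  assumes "k_adjacency_generator k (join_K1 H) S"
  shows "k_adjacency_generator k H {x. Some x \<in> S}"
  unfolding k_adjacency_generator_def
proof (intro conjI ballI impI)
  show "{x. Some x \<in> S} \<subseteq> pverts H"
    using assms by (auto simp: k_adjacency_generator_def pverts_join)
  fix x y assume xy: "x \<in> pverts H" "y \<in> pverts H" "x \<noteq> y"
  have "{w \<in> S. resolves (join_K1 H) (Some x) (Some y) w}
      = Some ` {w \<in> {x. Some x \<in> S}. resolves H x y w}" (is "?L = ?R")
  proof
    show "?L \<subseteq> ?R"
    proof
      fix w assume w: "w \<in> ?L"
      with xy obtain z where "w = Some z"
        using not_resolves_join_None[OF xy(1,2)] by (cases w) auto
      with w show "w \<in> ?R" by (simp add: resolves_join_Some)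
    qed
  qed (auto simp: resolves_join_Some)
  moreover have "k \<le> card {w \<in> S. resolves (join_K1 H) (Some x) (Some y) w}"
    using assms xy unfolding k_adjacency_generator_def by (auto simp: pverts_join)
  ultimately show "k \<le> card {w \<in> {x. Some x \<in> S}. resolves H x y w}"
    by (simp add: card_image)
qed

text \<open>
  The apex and \<open>x\<close> are resolved by all elements of \<open>S\<close> that are not neighbours of \<open>x\<close>, and at most
  \<open>D\<close> elements of \<open>S\<close> are neighbours.
\<close>

lemma k_adjacency_generator_join:
  assumes gen: "k_adjacency_generator k H S" and fin: "finite S"
    and degree: "\<And>x. x \<in> pverts H \<Longrightarrow> card {y. (x, y) \<in> parcs H} \<le> D"
    and finN: "\<And>x. x \<in> pverts H \<Longrightarrow> finite {y. (x, y) \<in> parcs H}"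
    and large: "k + D \<le> card S"
  shows "k_adjacency_generator k (join_K1 H) (Some ` S)"
proof -
  have S: "S \<subseteq> pverts H"
    using gen by (simp add: k_adjacency_generator_def)
  have apex: "k \<le> card {w \<in> Some ` S. resolves (join_K1 H) None (Some x) w}"
    if x: "x \<in> pverts H" for x
  proof -
    have "k \<le> card S - card {y. (x, y) \<in> parcs H}"
      using large degree[OF x] by simp
    also have "\<dots> \<le> card (S - {y. (x, y) \<in> parcs H})"
      using finN[OF x] by (rule diff_card_le_card_Diff)
    also have "\<dots> = card (Some ` (S - {y. (x, y) \<in> parcs H}))"
      by (simp add: card_image)
    also have "\<dots> \<le> card {w \<in> Some ` S. resolves (join_K1 H) None (Some x) w}"
      using fin S by (intro card_mono) (auto simp: resolves_def join_K1_def)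
    finally show ?thesis .
  qed
  have old: "k \<le> card {w \<in> Some ` S. resolves (join_K1 H) (Some x) (Some y) w}"
    if xy: "x \<in> pverts H" "y \<in> pverts H" "x \<noteq> y" for x y
  proof -
    have "{w \<in> Some ` S. resolves (join_K1 H) (Some x) (Some y) w}
        = Some ` {w \<in> S. resolves H x y w}"
      by (auto simp: resolves_join_Some)
    moreover have "k \<le> card {w \<in> S. resolves H x y w}"
      using gen xy unfolding k_adjacency_generator_def by blast
    ultimately show ?thesis
      by (simp add: card_image)
  qed
  show ?thesis
    unfolding k_adjacency_generator_def pverts_join
    using S apex old by (auto simp: resolves_commute[of _ "Some _" None])
qed

lemma k_adjacency_dim_join:
  assumes H: "pair_graph H" and gen: "\<exists>S. k_adjacency_generator k H S"
    and degree: "\<And>x. x \<in> pverts H \<Longrightarrow> card {y. (x, y) \<in> parcs H} \<le> D"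
    and large: "k + D \<le> k_adjacency_dim k H"
  shows "k_adjacency_dim k (join_K1 H) = k_adjacency_dim k H"
    and "\<exists>S. k_adjacency_generator k (join_K1 H) S"
proof -
  obtain B where B: "k_adjacency_generator k H B" "card B = k_adjacency_dim k H"
    using gen k_adjacency_basis by blast
  have fin: "finite (pverts H)"
    using H by (rule pair_graph_finite)
  have "finite B"
    using B(1) fin by (auto simp: k_adjacency_generator_def intro: finite_subset)
  moreover have "finite {y. (x, y) \<in> parcs H}" for x
    using fin pair_graph_arcD(2)[OF H] by (blast intro: finite_subset)
  ultimately have join: "k_adjacency_generator k (join_K1 H) (Some ` B)"
    using B degree large by (intro k_adjacency_generator_join) auto
  thus "\<exists>S. k_adjacency_generator k (join_K1 H) S"
    by blast
  show "k_adjacency_dim k (join_K1 H) = k_adjacency_dim k H"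
  proof (rule k_adjacency_dim_eqI[OF join])
    show "card (Some ` B) = k_adjacency_dim k H"
      using B(2) by (simp add: card_image)
    fix T assume T: "k_adjacency_generator k (join_K1 H) T"
    have "finite T"
      using T fin by (auto simp: k_adjacency_generator_def pverts_join intro: finite_subset)
    have "k_adjacency_dim k H \<le> card {x. Some x \<in> T}"
      using T by (intro k_adjacency_dim_le k_adjacency_generator_of_join)
    also have "\<dots> = card (Some ` {x. Some x \<in> T})"
      by (simp add: card_image)
    also have "\<dots> \<le> card T"
      using \<open>finite T\<close> by (intro card_mono) auto
    finally show "k_adjacency_dim k H \<le> card T" .
  qed
qed

section \<open>Paths\<close>

text \<open>
  A standard model, so that distinguishing vertices can be found by arithmetic on their positions.
\<close>

definition nat_path :: "nat \<Rightarrow> nat pair_pre_digraph" where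
  "nat_path m = \<lparr> pverts = {..<m},
     parcs = {(i, j). i < m \<and> j < m \<and> (j = Suc i \<or> i = Suc j)} \<rparr>"

lemma is_path_graph_iso:
  assumes "is_path_graph m P"
  obtains f where "bij_betw f (pverts (nat_path m)) (pverts P)"
    "\<And>i j. i \<in> pverts (nat_path m) \<Longrightarrow> j \<in> pverts (nat_path m) \<Longrightarrow>
       (f i, f j) \<in> parcs P \<longleftrightarrow> (i, j) \<in> parcs (nat_path m)"
proof -
  obtain xs where xs: "length xs = m" "distinct xs" "pverts P = set xs"
    "parcs P = {(xs ! i, xs ! j) | i j. i < m \<and> j < m \<and> (j = Suc i \<or> i = Suc j)}"
    using assms unfolding is_path_graph_def by blast
  have "bij_betw ((!) xs) (pverts (nat_path m)) (pverts P)"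
    unfolding nat_path_def using xs by (simp add: bij_betw_nth)
  moreover have "(xs ! i, xs ! j) \<in> parcs P \<longleftrightarrow> (i, j) \<in> parcs (nat_path m)"
    if "i \<in> pverts (nat_path m)" "j \<in> pverts (nat_path m)" for i j
    using that xs nth_eq_iff_index_eq[OF xs(2)] by (fastforce simp: nat_path_def)
  ultimately show ?thesis
    using that by blast
qed

lemma is_path_graph_nat_path: "0 < m \<Longrightarrow> is_path_graph m (nat_path m)"
proof -
  have "parcs (nat_path m) = {([0..<m] ! i, [0..<m] ! j) | i j.
      i < m \<and> j < m \<and> (j = Suc i \<or> i = Suc j)}"
  proof -
    have "{([0..<m] ! i, [0..<m] ! j) | i j. i < m \<and> j < m \<and> (j = Suc i \<or> i = Suc j)}
        = {(i, j) | i j. i < m \<and> j < m \<and> (j = Suc i \<or> i = Suc j)}"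
      by (intro Collect_cong iff_exI) auto
    thus ?thesis by (simp add: nat_path_def)
  qed
  moreover assume "0 < m"
  ultimately show ?thesis
    unfolding is_path_graph_def
    by (intro conjI exI[of _ "[0..<m]"]) (simp_all add: nat_path_def atLeast0LessThan)
qed

lemma is_path_graph_card:
  assumes "is_path_graph m P"
  shows "card (pverts P) = m"
  using assms by (auto simp: is_path_graph_def distinct_card)

lemma pair_graph_is_path_graph:
  assumes "is_path_graph m P"
  shows "pair_graph P"
proof -
  obtain xs where xs: "length xs = m" "distinct xs" "pverts P = set xs"
    "parcs P = {(xs ! i, xs ! j) | i j. i < m \<and> j < m \<and> (j = Suc i \<or> i = Suc j)}"
    using assms unfolding is_path_graph_def by blast
  show ?thesis
  proof (rule pair_graphI)
    fix x y assume "(x, y) \<in> parcs P"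
    then obtain i j where "x = xs ! i" "y = xs ! j" "i < m" "j < m" "j = Suc i \<or> i = Suc j"
      unfolding xs(4) by blast
    thus "x \<in> pverts P \<and> y \<in> pverts P \<and> x \<noteq> y \<and> (y, x) \<in> parcs P"
      unfolding xs(3,4) using xs(1,2) by (auto simp: nth_eq_iff_index_eq)
  qed (simp add: xs)
qed

lemma is_path_graph_degree:
  assumes "is_path_graph m P"
  shows "card {y. (x, y) \<in> parcs P} \<le> 2"
proof -
  obtain xs where xs: "length xs = m" "distinct xs" "pverts P = set xs"
    "parcs P = {(xs ! i, xs ! j) | i j. i < m \<and> j < m \<and> (j = Suc i \<or> i = Suc j)}"
    using assms unfolding is_path_graph_def by blast
  show ?thesis
  proof (cases "\<exists>i<m. x = xs ! i")
    case True
    then obtain i where i: "i < m" "x = xs ! i" by blast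
    have "{y. (x, y) \<in> parcs P} \<subseteq> {xs ! Suc i, xs ! (i - 1)}"
      using xs(1,2) i by (auto simp: xs(4) nth_eq_iff_index_eq)
    hence "card {y. (x, y) \<in> parcs P} \<le> card {xs ! Suc i, xs ! (i - 1)}"
      by (intro card_mono) auto
    also have "\<dots> \<le> 2"
      by (simp add: card_insert_if)
    finally show ?thesis .
  next
    case False
    hence "{y. (x, y) \<in> parcs P} = {}"
      by (auto simp: xs(4))
    thus ?thesis by simp
  qed
qed

lemma pverts_nat_path [simp]: "pverts (nat_path m) = {..<m}"
  by (simp add: nat_path_def)

lemma resolves_nat_path:
  assumes "i < m" "j < m" "w < m"
  shows "resolves (nat_path m) i j w \<longleftrightarrow>
    w = i \<or> w = j \<or> (w = Suc i \<or> i = Suc w) \<noteq> (w = Suc j \<or> j = Suc w)"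
  using assms by (auto simp: resolves_def nat_path_def)

lemma k_adjacency_generator_nat_pathI:
  assumes S: "S \<subseteq> {..<m}"
    and sep: "\<And>i j. i < j \<Longrightarrow> j < m \<Longrightarrow> \<exists>A. k \<le> card (A \<inter> S) \<and> finite A \<and>
      (\<forall>w\<in>A \<inter> S. resolves (nat_path m) i j w)"
  shows "k_adjacency_generator k (nat_path m) S"
proof -
  have fin: "finite S"
    using S by (rule finite_subset) simp
  have less: "k \<le> card {w \<in> S. resolves (nat_path m) i j w}" if ij: "i < j" "j < m" for i j
  proof -
    obtain A where A: "k \<le> card (A \<inter> S)" "\<forall>w\<in>A \<inter> S. resolves (nat_path m) i j w"
      using sep[OF ij] by blast
    have "card (A \<inter> S) \<le> card {w \<in> S. resolves (nat_path m) i j w}"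
      using A(2) fin by (intro card_mono) auto
    with A(1) show ?thesis by simp
  qed
  have "k \<le> card {w \<in> S. resolves (nat_path m) i j w}" if "i < m" "j < m" "i \<noteq> j" for i j
  proof (cases "i < j")
    case False
    with that show ?thesis
      using less[of j i] by (simp add: resolves_commute[of _ i j])
  qed (use that less in simp)
  thus ?thesis
    using S by (simp add: k_adjacency_generator_def)
qed

lemma k_adjacency_generator_nat_path_window:
  assumes gen: "k_adjacency_generator k (nat_path m) S" and ij: "i < m" "j < m" "i \<noteq> j"
    and A: "finite A" "\<And>w. w < m \<Longrightarrow> resolves (nat_path m) i j w \<Longrightarrow> w \<in> A"
  shows "k \<le> card (A \<inter> S)"
proof -
  have "k \<le> card {w \<in> S. resolves (nat_path m) i j w}"
    using gen ij unfolding k_adjacency_generator_def by simp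
  also have "\<dots> \<le> card (A \<inter> S)"
    using A gen by (intro card_mono) (auto simp: k_adjacency_generator_def)
  finally show ?thesis .
qed

text \<open>
  For \<open>i = 0\<close> the element \<open>i - 1\<close> is \<open>0\<close> by truncated subtraction, and for \<open>i = m - 2\<close> the element
  \<open>i + 2\<close> is not a vertex; so the window shrinks to three vertices at both ends.
\<close>

lemma window_adjacent:
  assumes "k_adjacency_generator k (nat_path m) S" "Suc i < m"
  shows "k \<le> card ({i - 1, i, Suc i, i + 2} \<inter> S)"
  by (rule k_adjacency_generator_nat_path_window[where i = i and j = "Suc i"])
    (use assms in \<open>auto simp: resolves_nat_path\<close>)

lemma window_gap:
  assumes "k_adjacency_generator k (nat_path m) S" "i + 2 < m"
  shows "k \<le> card ({i - 1, i, i + 2, i + 3} \<inter> S)"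
  by (rule k_adjacency_generator_nat_path_window[where i = i and j = "i + 2"])
    (use assms in \<open>auto simp: resolves_nat_path\<close>)

lemma card_Int_insert:
  "finite A \<Longrightarrow> a \<notin> A \<Longrightarrow> card (insert a A \<inter> S) = of_bool (a \<in> S) + card (A \<inter> S)"
  by (simp add: Int_insert_left)

section \<open>Paths, one distinguishing vertex\<close>

text \<open>
  Let \<open>t w\<close> be the set of neighbours in \<open>S\<close> of a vertex \<open>w\<close> outside \<open>S\<close>. Since only elements of \<open>S\<close>
  adjacent to exactly one of two outside vertices can resolve them, \<open>t\<close> is injective: at most one
  \<open>t w\<close> is empty and at most \<open>card S\<close> are singletons. Counting edges between \<open>S\<close> and its complement
  from both sides bounds the sum of all \<open>card (t w)\<close> by \<open>2 * card S\<close>.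
\<close>

lemma k_adjacency_generator_1_card:
  assumes H: "pair_graph H" and S: "k_adjacency_generator 1 H S"
    and degree: "\<And>x. x \<in> pverts H \<Longrightarrow> card {y. (x, y) \<in> parcs H} \<le> 2"
  shows "2 * card (pverts H) \<le> 5 * card S + 2"
proof -
  let ?V = "pverts H"
  let ?W = "?V - S"
  define t where "t w = {s \<in> S. (w, s) \<in> parcs H}" for w
  have fin: "finite ?V"
    using H by (rule pair_graph_finite)
  have sub: "S \<subseteq> ?V"
    using S by (simp add: k_adjacency_generator_def)
  have fin_S: "finite S"
    using sub fin by (rule finite_subset)
  have inj: "w = w'" if w: "w \<in> ?W" "w' \<in> ?W" "t w = t w'" for w w'
  proof (rule ccontr)
    assume "w \<noteq> w'"
    hence "1 \<le> card {s \<in> S. resolves H w w' s}"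
      using S w unfolding k_adjacency_generator_def by blast
    hence "{s \<in> S. resolves H w w' s} \<noteq> {}"
      by (metis card.empty not_one_le_zero)
    then obtain s where "s \<in> S" "resolves H w w' s"
      by blast
    with w show False
      by (auto simp: resolves_def t_def)
  qed
  have empty: "card {w \<in> ?W. card (t w) = 0} \<le> 1"
  proof -
    have "finite (t w)" for w
      using fin_S by (simp add: t_def)
    hence "w = w'" if "w \<in> {w \<in> ?W. card (t w) = 0}" "w' \<in> {w \<in> ?W. card (t w) = 0}" for w w'
      using that inj[of w w'] by auto
    thus ?thesis
      using fin card_le_Suc0_iff_eq[of "{w \<in> ?W. card (t w) = 0}"] by auto
  qed
  have single: "card {w \<in> ?W. card (t w) = 1} \<le> card S"
  proof -
    have "inj_on t {w \<in> ?W. card (t w) = 1}"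
      using inj by (auto intro: inj_onI)
    moreover have "t ` {w \<in> ?W. card (t w) = 1} \<subseteq> (\<lambda>s. {s}) ` S"
      by (auto simp: t_def card_1_singleton_iff)
    ultimately have "card {w \<in> ?W. card (t w) = 1} \<le> card ((\<lambda>s. {s}) ` S)"
      using fin_S by (intro card_inj_on_le[of t]) auto
    thus ?thesis
      using card_image_le[OF fin_S, of "\<lambda>s. {s}"] by linarith
  qed
  have edges: "(\<Sum>w\<in>?W. card (t w)) \<le> 2 * card S"
  proof -
    have "(\<Sum>w\<in>?W. card (t w)) = (\<Sum>s\<in>S. card {w \<in> ?W. (w, s) \<in> parcs H})"
      unfolding t_def by (rule sum_multicount_gen) (use fin fin_S in auto)
    also have "\<dots> \<le> (\<Sum>s\<in>S. 2)"
    proof (rule sum_mono)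
      fix s assume s: "s \<in> S"
      have "card {w \<in> ?W. (w, s) \<in> parcs H} \<le> card {y. (s, y) \<in> parcs H}"
      proof (rule card_mono)
        show "finite {y. (s, y) \<in> parcs H}"
          by (rule finite_subset[OF _ fin]) (use pair_graph_arcD(2)[OF H] in blast)
        show "{w \<in> ?W. (w, s) \<in> parcs H} \<subseteq> {y. (s, y) \<in> parcs H}"
          using pair_graph_arcD(4)[OF H] by blast
      qed
      also have "\<dots> \<le> 2"
        using degree s sub by blast
      finally show "card {w \<in> ?W. (w, s) \<in> parcs H} \<le> 2" .
    qed
    finally show ?thesis by simp
  qed
  \<comment> \<open>Each outside vertex counts 2: a deficit of 1 for singletons, of 2 for the empty set.\<close>
  have "2 * card ?W = (\<Sum>w\<in>?W. 2)"
    by simp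
  also have "\<dots> \<le> (\<Sum>w\<in>?W. card (t w) + of_bool (card (t w) = 1) + 2 * of_bool (card (t w) = 0))"
    by (rule sum_mono) (auto simp: of_bool_def)
  also have "\<dots> = (\<Sum>w\<in>?W. card (t w)) + card {w \<in> ?W. card (t w) = 1}
      + 2 * card {w \<in> ?W. card (t w) = 0}"
    using fin by (simp add: sum.distrib sum_distrib_left[symmetric] sum_of_bool_eq Int_def)
  finally have "2 * card ?W \<le> 3 * card S + 2"
    using edges empty single by linarith
  moreover have "card ?V = card ?W + card S"
    using sub fin by (metis card_Diff_subset card_mono fin_S le_add_diff_inverse2)
  ultimately show ?thesis
    by simp
qed

lemma nat_path_adjacency_dim_1_lower:
  assumes "0 < m" "k_adjacency_generator 1 (nat_path m) S"
  shows "(2 * m + 2) div 5 \<le> card S"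
proof -
  have p: "is_path_graph m (nat_path m)"
    using assms(1) by (rule is_path_graph_nat_path)
  have "2 * m \<le> 5 * card S + 2"
    using k_adjacency_generator_1_card[OF pair_graph_is_path_graph[OF p] assms(2)]
      is_path_graph_degree[OF p] is_path_graph_card[OF p] by simp
  thus ?thesis by linarith
qed

lemma card_two_classes_mod_5:
  fixes a b m :: nat
  assumes "a < 5" "b < 5"
  shows "card {i. i < m \<and> (i mod 5 = a \<or> i mod 5 = b)}
    \<le> 2 * (m div 5) + of_bool (a < m mod 5) + of_bool (b < m mod 5)"
proof -
  have one: "card {i. i < m \<and> i mod 5 = a} \<le> m div 5 + of_bool (a < m mod 5)" if "a < 5" for a
  proof -
    have "{i. i < m \<and> i mod 5 = a} \<subseteq> (\<lambda>q. 5 * q + a) ` {..<m div 5 + of_bool (a < m mod 5)}"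
    proof
      fix i assume i: "i \<in> {i. i < m \<and> i mod 5 = a}"
      hence "i = 5 * (i div 5) + a" by auto
      moreover have "i div 5 < m div 5 + of_bool (a < m mod 5)"
      proof -
        have "5 * (i div 5) + a = i" "5 * (m div 5) + m mod 5 = m" "m mod 5 < 5" "i < m"
          using i by auto
        thus ?thesis
          unfolding of_bool_def by (split if_split, intro conjI impI) linarith+
      qed
      ultimately show "i \<in> (\<lambda>q. 5 * q + a) ` {..<m div 5 + of_bool (a < m mod 5)}"
        by blast
    qed
    from surj_card_le[OF _ this] show ?thesis by simp
  qed
  have "{i. i < m \<and> (i mod 5 = a \<or> i mod 5 = b)}
      = {i. i < m \<and> i mod 5 = a} \<union> {i. i < m \<and> i mod 5 = b}"
    by blast
  hence "card {i. i < m \<and> (i mod 5 = a \<or> i mod 5 = b)}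
      \<le> card {i. i < m \<and> i mod 5 = a} + card {i. i < m \<and> i mod 5 = b}"
    by (simp add: card_Un_le)
  also have "\<dots> \<le> 2 * (m div 5) + of_bool (a < m mod 5) + of_bool (b < m mod 5)"
    using one[OF assms(1)] one[OF assms(2)] by simp
  finally show ?thesis .
qed

lemma mod_5_cases:
  fixes l :: nat
  shows "l mod 5 = 0 \<or> l mod 5 = 1 \<or> l mod 5 = 2 \<or> l mod 5 = 3 \<or> l mod 5 = 4"
proof -
  have "x = 0 \<or> x = 1 \<or> x = 2 \<or> x = 3 \<or> x = 4" if "x < 5" for x :: nat
    using that by linarith
  from this[of "l mod 5"] show ?thesis by simp
qed

lemma double_plus_2_div_5:
  fixes m :: nat
  shows "(2 * m + 2) div 5 = 2 * (m div 5) + (2 * (m mod 5) + 2) div 5"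
proof -
  have "2 * m + 2 = (2 * (m mod 5) + 2) + 5 * (2 * (m div 5))"
    using mult_div_mod_eq[of 5 m] by linarith
  hence "(2 * m + 2) div 5 = ((2 * (m mod 5) + 2) + 5 * (2 * (m div 5))) div 5"
    by (rule arg_cong)
  also have "\<dots> = 2 * (m div 5) + (2 * (m mod 5) + 2) div 5"
    by (rule div_mult_self2) simp
  finally show ?thesis .
qed

text \<open>
  With residues 1 and 3, the outside vertices have residue 0, 2 or 4, and each of them is determined
  by its neighbours in the set: the next vertex, both neighbours, or the previous vertex. The only
  problem is at the right end: if \<open>m mod 5 = 3\<close>, the last vertex has residue 2 and lacks its right
  neighbour, so it is confused with the vertex two steps before. In this case the residues 2 and 4
  are used, where the end is harmless and vertex 0 is the only one without neighbours in the set.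
\<close>

lemma nat_path_adjacency_dim_1_upper:
  "\<exists>S. k_adjacency_generator 1 (nat_path m) S \<and> card S \<le> (2 * m + 2) div 5"
proof (cases "m mod 5 = 3")
  case False
  let ?S = "{i. i < m \<and> (i mod 5 = 1 \<or> i mod 5 = 3)}"
  have "k_adjacency_generator 1 (nat_path m) ?S"
  proof (rule k_adjacency_generator_nat_pathI)
    fix i j assume ij: "i < j" "j < m"
    from mod_5_cases[of i] consider "i mod 5 = 1 \<or> i mod 5 = 3" | "i mod 5 = 2 \<or> i mod 5 = 4"
      | "i mod 5 = 0" "j \<noteq> i + 2" | "i mod 5 = 0" "j = i + 2"
      by metis
    hence "\<exists>w\<in>?S. resolves (nat_path m) i j w"
    proof cases
      case 1
      thus ?thesis
        using ij by (intro bexI[of _ i]) (simp_all add: resolves_def)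
    next
      case 2
      then obtain l where l: "i = Suc l"
        by (cases i) auto
      with 2 have "l mod 5 = 1 \<or> l mod 5 = 3"
        by (auto simp: mod_Suc split: if_splits)
      thus ?thesis
        using ij l by (intro bexI[of _ l]) (simp_all add: resolves_nat_path)
    next
      case 3
      hence "Suc i mod 5 = 1"
        by (simp add: mod_Suc)
      thus ?thesis
        using ij 3 by (intro bexI[of _ "Suc i"]) (simp_all add: resolves_nat_path)
    next
      case 4
      hence "Suc j mod 5 = 3"
        using mod_add_cong[of i 5 0 3 3] by (simp add: add.commute)
      moreover from this False have "Suc j \<noteq> m"
        by blast
      ultimately show ?thesis
        using ij 4 by (intro bexI[of _ "Suc j"]) (simp_all add: resolves_nat_path)
    qed
    then obtain w where "w \<in> ?S" "resolves (nat_path m) i j w" by blast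
    thus "\<exists>A. 1 \<le> card (A \<inter> ?S) \<and> finite A \<and> (\<forall>w\<in>A \<inter> ?S. resolves (nat_path m) i j w)"
      by (intro exI[of _ "{w}"]) auto
  qed auto
  moreover have "card ?S \<le> (2 * m + 2) div 5"
  proof -
    have "m mod 5 < 5" by simp
    hence "m mod 5 \<in> {0, 1, 2, 4}" using False by auto
    hence "2 * (m div 5) + of_bool (1 < m mod 5) + of_bool (3 < m mod 5) \<le> (2 * m + 2) div 5"
      by (subst double_plus_2_div_5) auto
    with card_two_classes_mod_5[of 1 3 m] show ?thesis by linarith
  qed
  ultimately show ?thesis by blast
next
  case True
  let ?S = "{i. i < m \<and> (i mod 5 = 2 \<or> i mod 5 = 4)}"
  have "k_adjacency_generator 1 (nat_path m) ?S"
  proof (rule k_adjacency_generator_nat_pathI)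
    fix i j assume ij: "i < j" "j < m"
    have succ: "Suc l < m \<and> (Suc l mod 5 = 2 \<or> Suc l mod 5 = 4)"
      if "l < m" "l mod 5 = 1 \<or> l mod 5 = 3" for l
    proof -
      have "Suc l mod 5 = 2 \<or> Suc l mod 5 = 4"
        using that(2) by (auto simp: mod_Suc)
      with True that(1) show ?thesis
        by (cases "Suc l = m") auto
    qed
    from mod_5_cases[of i] mod_5_cases[of j] consider "i \<in> ?S" | "j \<in> ?S"
      | "i \<noteq> 0" "i mod 5 = 0 \<or> i mod 5 = 3"
      | "i mod 5 = 1" "j \<noteq> i + 2" | "i mod 5 = 1" "j = i + 2"
      | "i = 0" "j mod 5 = 0" | "i = 0" "j mod 5 = 1 \<or> j mod 5 = 3"
      using ij by (cases "i = 0") auto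
    hence "\<exists>w\<in>?S. resolves (nat_path m) i j w"
    proof cases
      case 1
      thus ?thesis by (intro bexI[of _ i]) (simp_all add: resolves_def)
    next
      case 2
      thus ?thesis by (intro bexI[of _ j]) (simp_all add: resolves_def)
    next
      case 3
      then obtain l where l: "i = Suc l"
        by (cases i) auto
      with 3 have "l mod 5 = 2 \<or> l mod 5 = 4"
        by (auto simp: mod_Suc split: if_splits)
      thus ?thesis
        using ij l by (intro bexI[of _ l]) (simp_all add: resolves_nat_path)
    next
      case 4
      with succ[of i] ij show ?thesis
        by (intro bexI[of _ "Suc i"]) (simp_all add: resolves_nat_path)
    next
      case 5
      hence "j mod 5 = 3"
        using mod_add_cong[of i 5 1 2 2] by (simp add: add.commute)
      with succ[of j] ij 5 show ?thesis
        by (intro bexI[of _ "Suc j"]) (simp_all add: resolves_nat_path)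
    next
      case 6
      then obtain l where l: "j = Suc l"
        using ij by (cases j) auto
      with 6 have "l mod 5 = 4"
        by (auto simp: mod_Suc split: if_splits)
      with ij 6 l show ?thesis
        by (intro bexI[of _ l]) (auto simp: resolves_nat_path)
    next
      case 7
      with succ[of j] ij show ?thesis
        by (intro bexI[of _ "Suc j"]) (auto simp: resolves_nat_path)
    qed
    then obtain w where "w \<in> ?S" "resolves (nat_path m) i j w" by blast
    thus "\<exists>A. 1 \<le> card (A \<inter> ?S) \<and> finite A \<and> (\<forall>w\<in>A \<inter> ?S. resolves (nat_path m) i j w)"
      by (intro exI[of _ "{w}"]) auto
  qed auto
  moreover have "card ?S \<le> (2 * m + 2) div 5"
  proof -
    have "2 * (m div 5) + of_bool (2 < m mod 5) + of_bool (4 < m mod 5) \<le> (2 * m + 2) div 5"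
      using True by (subst double_plus_2_div_5) simp
    with card_two_classes_mod_5[of 2 4 m] show ?thesis by linarith
  qed
  ultimately show ?thesis by blast
qed

section \<open>Paths, two distinguishing vertices\<close>

text \<open>
  Every vertex \<open>i\<close> has itself or its predecessor in the set, and itself or its successor. For
  \<open>i < j\<close>, one resolving vertex is found at or to the left of \<open>i\<close>, the other at or to the right of
  \<open>j\<close>.
\<close>

lemma nat_path_adjacency_dim_2_upper:
  assumes "0 < m"
  shows "\<exists>S. k_adjacency_generator 2 (nat_path m) S \<and> card S \<le> m div 2 + 1"
proof -
  let ?S = "{i. i < m \<and> (even i \<or> Suc i = m)}"
  have "k_adjacency_generator 2 (nat_path m) ?S"
  proof (rule k_adjacency_generator_nat_pathI)
    fix i j assume ij: "i < j" "j < m"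
    define a where "a = (if even i then i else i - 1)"
    define b where "b = (if even j \<or> Suc j = m then j else Suc j)"
    have "a \<in> ?S" "b \<in> ?S" "a < b"
      using ij by (auto simp: a_def b_def)
    moreover have "resolves (nat_path m) i j a" "resolves (nat_path m) i j b"
      using ij by (auto simp: a_def b_def resolves_nat_path elim!: oddE)
    ultimately show "\<exists>A. 2 \<le> card (A \<inter> ?S) \<and> finite A \<and> (\<forall>w\<in>A \<inter> ?S. resolves (nat_path m) i j w)"
      by (intro exI[of _ "{a, b}"]) (auto simp: card_insert_if)
  qed auto
  moreover have "card ?S \<le> m div 2 + 1"
  proof -
    \<comment> \<open>The minimum maps the excess value \<open>q = m div 2\<close> to the last vertex.\<close>
    have "?S \<subseteq> (\<lambda>q. min (2 * q) (m - 1)) ` {..m div 2}"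
    proof
      fix i assume i: "i \<in> ?S"
      show "i \<in> (\<lambda>q. min (2 * q) (m - 1)) ` {..m div 2}"
      proof (cases "even i")
        case True
        with i show ?thesis by (intro image_eqI[of _ _ "i div 2"]) auto
      next
        case False
        with i show ?thesis by (intro image_eqI[of _ _ "m div 2"]) auto
      qed
    qed
    from surj_card_le[OF _ this] show ?thesis by simp
  qed
  ultimately show ?thesis by blast
qed

text \<open>
  A window of four vertices contains two elements of \<open>S\<close>, and so do the first three and the last
  three vertices. Tiling with such windows gives the bound for \<open>m mod 4 \<in> {2, 3}\<close>. In the other
  cases the gain comes from the first five vertices, which contain three elements of \<open>S\<close>: if 3 and
  4 are both missing, then the window conditions put 0, 1 and 2 into \<open>S\<close>.
\<close>

lemma nat_path_adjacency_dim_2_lower: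
  assumes m: "6 \<le> m" and gen: "k_adjacency_generator 2 (nat_path m) S"
  shows "m div 2 + 1 \<le> card S"
proof -
  have S: "S \<subseteq> {..<m}"
    using gen by (simp add: k_adjacency_generator_def)
  have fin: "finite S"
    using S by (rule finite_subset) simp
  have start: "2 \<le> card ({0, 1, 2} \<inter> S)"
    using window_adjacent[OF gen, of 0] m by (simp add: numeral_2_eq_2)
  have start': "2 \<le> card ({0, 2, 3} \<inter> S)"
    using window_gap[OF gen, of 0] m by (simp add: numeral_2_eq_2)
  have window: "2 \<le> card ({i, i + 1, i + 2, i + 3} \<inter> S)" if "i + 3 \<le> m" for i
    using window_adjacent[OF gen, of "Suc i"] that by (simp add: numeral_eq_Suc)
  have first3: "2 \<le> card ({..<3} \<inter> S)"
  proof -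
    have "{..<3} = {0, 1, 2 :: nat}" by auto
    thus ?thesis using start by simp
  qed
  have first5: "3 \<le> card ({..<5} \<inter> S)"
  proof -
    have "{..<5} = {0, 1, 2, 3, 4 :: nat}" by auto
    have next4: "2 \<le> card ({1, 2, 3, 4} \<inter> S)"
      using window[of 1] m by (simp add: numeral_eq_Suc)
    have "2 \<le> of_bool (0 \<in> S) + of_bool (1 \<in> S) + (of_bool (2 \<in> S) :: nat)"
      "2 \<le> of_bool (0 \<in> S) + of_bool (2 \<in> S) + (of_bool (3 \<in> S) :: nat)"
      "2 \<le> of_bool (1 \<in> S) + of_bool (2 \<in> S) + of_bool (3 \<in> S) + (of_bool (4 \<in> S) :: nat)"
      using start start' next4 by (simp_all add: card_Int_insert)
    hence "3 \<le> of_bool (0 \<in> S) + of_bool (1 \<in> S) + of_bool (2 \<in> S) + of_bool (3 \<in> S)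
        + (of_bool (4 \<in> S) :: nat)"
      by (simp split: split_of_bool_asm split_of_bool)
    with \<open>{..<5} = _\<close> show ?thesis
      by (simp add: card_Int_insert)
  qed
  have grow: "c + 2 * a \<le> card ({..<b + 4 * a} \<inter> S)"
    if "c \<le> card ({..<b} \<inter> S)" "b + 4 * a \<le> m" for a b c
    using that(2)
  proof (induction a)
    case (Suc a)
    let ?i = "b + 4 * a"
    have "{..<b + 4 * Suc a} = {..<?i} \<union> {?i, ?i + 1, ?i + 2, ?i + 3}" by auto
    hence "{..<b + 4 * Suc a} \<inter> S = {..<?i} \<inter> S \<union> {?i, ?i + 1, ?i + 2, ?i + 3} \<inter> S"
      by (simp only: Int_Un_distrib2)
    hence "card ({..<b + 4 * Suc a} \<inter> S)
        = card ({..<?i} \<inter> S \<union> {?i, ?i + 1, ?i + 2, ?i + 3} \<inter> S)"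
      by (rule arg_cong)
    also have "\<dots> = card ({..<?i} \<inter> S) + card ({?i, ?i + 1, ?i + 2, ?i + 3} \<inter> S)"
      by (rule card_Un_disjoint) auto
    finally have "card ({..<b + 4 * Suc a} \<inter> S)
        = card ({..<?i} \<inter> S) + card ({?i, ?i + 1, ?i + 2, ?i + 3} \<inter> S)" .
    with Suc window[of ?i] show ?case by simp
  qed (use that(1) in simp)
  have total: "c + 2 * a + 2 \<le> card S" if "c \<le> card ({..<b} \<inter> S)" "b + 4 * a + 3 \<le> m" for a b c
  proof -
    have "card ({..<b + 4 * a} \<inter> S) + card ({m - 3, m - 3 + 1, m - 3 + 2, m - 3 + 3} \<inter> S)
        = card ({..<b + 4 * a} \<inter> S \<union> {m - 3, m - 3 + 1, m - 3 + 2, m - 3 + 3} \<inter> S)"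
      by (rule card_Un_disjoint[symmetric]) (use that(2) in auto)
    also have "\<dots> \<le> card S"
      using fin by (intro card_mono) auto
    finally show ?thesis
      using grow[OF that(1), of a] window[of "m - 3"] that(2) m by linarith
  qed
  have "m mod 4 < 4" by simp
  then consider "m mod 4 = 2 \<or> m mod 4 = 3" | "m mod 4 = 0 \<or> m mod 4 = 1" by linarith
  thus ?thesis
  proof cases
    case 1
    \<comment> \<open>First three vertices, \<open>a\<close> windows of four, last three vertices.\<close>
    obtain a where "m = 4 * a + 6 \<or> m = 4 * a + 7"
    proof
      show "m = 4 * (m div 4 - 1) + 6 \<or> m = 4 * (m div 4 - 1) + 7"
        using 1 m mult_div_mod_eq[of 4 m] by (elim disjE) linarith+
    qed
    hence "3 + 4 * a + 3 \<le> m" "m div 2 + 1 = 2 + 2 * a + 2"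
      by auto
    with total[OF first3, of a] show ?thesis by simp
  next
    case 2
    \<comment> \<open>First five vertices, \<open>a\<close> windows of four, last three vertices.\<close>
    obtain a where "m = 4 * a + 8 \<or> m = 4 * a + 9"
    proof
      show "m = 4 * (m div 4 - 2) + 8 \<or> m = 4 * (m div 4 - 2) + 9"
        using 2 m mult_div_mod_eq[of 4 m] by (elim disjE) linarith+
    qed
    hence "5 + 4 * a + 3 \<le> m" "m div 2 + 1 = 3 + 2 * a + 2"
      by auto
    with total[OF first5, of a] show ?thesis by simp
  qed
qed

section \<open>Paths, three distinguishing vertices\<close>

text \<open>
  Each window has at most one element outside \<open>S\<close>, and none if it is shortened by an end of the
  path. Hence the missing vertices lie in \<open>{4..m - 5}\<close> and any two of them are at least 5 apart;
  differences 1, 2, 3 are excluded by adjacent pairs, difference 4 by pairs at distance 2. So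
  \<open>t \<mapsto> (t - 4) div 5\<close> is injective on them.
\<close>

lemma nat_path_adjacency_dim_3_lower:
  assumes m: "6 \<le> m" and gen: "k_adjacency_generator 3 (nat_path m) S"
  shows "m - (m - 4) div 5 \<le> card S"
proof -
  define T where "T = {..<m} - S"
  have S: "S \<subseteq> {..<m}"
    using gen by (simp add: k_adjacency_generator_def)
  have three: "{a, b, c} \<subseteq> S" if "3 \<le> card ({a, b, c} \<inter> S)" for a b c
  proof -
    have "card {a, b, c} \<le> 3" by (simp add: card_insert_if)
    with that have "{a, b, c} \<inter> S = {a, b, c}"
      by (intro card_subset_eq) (auto intro: order_trans antisym card_mono)
    thus ?thesis by blast
  qed
  have four: "card (T \<inter> {a, b, c, e}) \<le> 1" if "3 \<le> card ({a, b, c, e} \<inter> S)" for a b c e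
  proof -
    have "card {a, b, c, e} \<le> 4" by (simp add: card_insert_if)
    moreover have "card ({a, b, c, e} \<inter> S) + card (T \<inter> {a, b, c, e}) \<le> card {a, b, c, e}"
      by (subst card_Un_disjoint[symmetric]) (auto simp: T_def intro!: card_mono)
    ultimately show ?thesis using that by linarith
  qed
  have "{0, 1, 2} \<subseteq> S" "{0, 2, 3} \<subseteq> S"
    using window_adjacent[OF gen, of 0] window_gap[OF gen, of 0] m
    by (intro three; simp add: numeral_eq_Suc)+
  hence start: "{0, 1, 2, 3} \<subseteq> S" by simp
  define r where "r = m - 4"
  hence r: "m = r + 4"
    using m by simp
  have "r + 4 \<notin> S"
    using S r by auto
  hence drop: "{a, b, c, r + 4} \<inter> S = {a, b, c} \<inter> S" for a b c
    by auto
  have "3 \<le> card ({r + 1, r + 2, r + 3, r + 4} \<inter> S)" "3 \<le> card ({r, r + 1, r + 3, r + 4} \<inter> S)"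
    using window_adjacent[OF gen, of "r + 2"] window_gap[OF gen, of "r + 1"] r
    by (simp_all add: numeral_eq_Suc)
  hence "{r + 1, r + 2, r + 3} \<subseteq> S" "{r, r + 1, r + 3} \<subseteq> S"
    unfolding drop by (blast dest: three[of "r + 1" "r + 2" "r + 3"] three[of r "r + 1" "r + 3"])+
  hence final: "{r, r + 1, r + 2, r + 3} \<subseteq> S" by simp
  have range: "4 \<le> t \<and> t + 5 \<le> m" if "t \<in> T" for t
  proof -
    have "t < m" "t \<notin> S"
      using that by (auto simp: T_def)
    have ne: "t \<noteq> s" if "s \<in> S" for s
      using that \<open>t \<notin> S\<close> by blast
    have "t \<noteq> 0" "t \<noteq> 1" "t \<noteq> 2" "t \<noteq> 3"
      using start by (intro ne, simp)+
    hence "4 \<le> t"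
      by linarith
    have "t \<noteq> r" "t \<noteq> r + 1" "t \<noteq> r + 2" "t \<noteq> r + 3"
      using final by (intro ne, simp)+
    hence "t < r"
      using r \<open>t < m\<close> by linarith
    with \<open>4 \<le> t\<close> show ?thesis
      using r by simp
  qed
  have apart: "t + 5 \<le> u" if tu: "t \<in> T" "u \<in> T" "t < u" for t u
  proof (rule ccontr)
    assume "\<not> t + 5 \<le> u"
    have t: "4 \<le> t" "u + 5 \<le> m"
      using range tu by blast+
    have 1: "card (T \<inter> {t, t + 1, t + 2, t + 3}) \<le> 1"
      using window_adjacent[OF gen, of "Suc t"] t tu by (intro four) (simp add: numeral_eq_Suc)
    have 2: "card (T \<inter> {t, t + 1, t + 3, t + 4}) \<le> 1"
      using window_gap[OF gen, of "Suc t"] t tu by (intro four) (simp add: numeral_eq_Suc)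
    have "{t, u} \<subseteq> T \<inter> {t, t + 1, t + 2, t + 3} \<or> {t, u} \<subseteq> T \<inter> {t, t + 1, t + 3, t + 4}"
      using tu \<open>\<not> t + 5 \<le> u\<close> by auto
    hence "card {t, u} \<le> 1"
      using 1 2 by (meson card_mono finite.emptyI finite_insert finite_Int le_trans)
    with tu(3) show False by simp
  qed
  have div_less: "x div 5 < y div 5" if "x + 5 \<le> y" for x y :: nat
    using div_le_mono[OF that, of 5] by simp
  have "card T \<le> card {..<(m - 4) div 5}"
  proof (rule card_inj_on_le)
    show "inj_on (\<lambda>t. (t - 4) div 5) T"
    proof (rule linorder_inj_onI')
      fix t u assume "t \<in> T" "u \<in> T" "t < u"
      hence "t + 5 \<le> u" "4 \<le> t"
        using apart[of t u] range[of t] by blast+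
      hence "(t - 4) + 5 \<le> u - 4"
        by linarith
      from div_less[OF this] show "(t - 4) div 5 \<noteq> (u - 4) div 5"
        by simp
    qed
    show "(\<lambda>t. (t - 4) div 5) ` T \<subseteq> {..<(m - 4) div 5}"
    proof
      fix q assume "q \<in> (\<lambda>t. (t - 4) div 5) ` T"
      then obtain t where q: "q = (t - 4) div 5" and "t \<in> T" by blast
      hence "(t - 4) + 5 \<le> m - 4"
        using range[of t] by linarith
      from div_less[OF this] show "q \<in> {..<(m - 4) div 5}"
        by (simp add: q)
    qed
  qed simp
  moreover have "card T = m - card S"
    unfolding T_def using S by (simp add: card_Diff_subset finite_subset)
  ultimately show ?thesis by simp
qed

text \<open>
  The omitted vertices have residue 4 modulo 5 and are at least 4 away from the right end. Any set of
  vertices within five consecutive positions loses at most one element, and nothing is lost among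
  the first or last four vertices. Pairs at distance 1 or 2 are resolved by a full window of four
  vertices, or by three vertices at an end. For more distant pairs the two closed neighbourhoods are
  disjoint and each keeps two elements.
\<close>

lemma nat_path_adjacency_dim_3_upper:
  assumes m: "6 \<le> m"
  shows "\<exists>S. k_adjacency_generator 3 (nat_path m) S \<and> card S \<le> m - (m - 4) div 5"
proof -
  let ?T = "{i. i + 5 \<le> m \<and> i mod 5 = 4}"
  let ?S = "{..<m} - ?T"
  have near: "c \<le> card (A \<inter> ?S)"
    if A: "A \<subseteq> {a..<a + 5}" "A \<subseteq> {..<m}" and c: "c + 1 \<le> card A" for A a c
  proof -
    have fin: "finite A" using A(1) by (rule finite_subset) simp
    have "i = j" if "i \<in> A \<inter> ?T" "j \<in> A \<inter> ?T" for i j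
    proof -
      have near: "a \<le> i" "i < a + 5" "a \<le> j" "j < a + 5"
        using that A by auto
      have rep: "i = 5 * (i div 5) + 4" "j = 5 * (j div 5) + 4"
        using that mult_div_mod_eq[of 5 i] mult_div_mod_eq[of 5 j] by auto
      with near have "i div 5 = j div 5"
        by linarith
      with rep show ?thesis
        by metis
    qed
    hence "card (A \<inter> ?T) \<le> Suc 0"
      using fin by (subst card_le_Suc0_iff_eq) auto
    moreover have "(A \<inter> ?S) \<union> (A \<inter> ?T) = A"
      using A(2) by auto
    hence "card A \<le> card (A \<inter> ?S) + card (A \<inter> ?T)"
      using card_Un_le[of "A \<inter> ?S" "A \<inter> ?T"] by (simp only:)
    ultimately show ?thesis using c by linarith
  qed
  have border: "A \<inter> ?S = A" if "A \<subseteq> {..<4} \<or> A \<subseteq> {m - 4..<m}" for A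
    using that m by (auto simp: subset_iff)
  have "k_adjacency_generator 3 (nat_path m) ?S"
  proof (rule k_adjacency_generator_nat_pathI)
    fix i j assume ij: "i < j" "j < m"
    have wit: "\<exists>A. 3 \<le> card (A \<inter> ?S) \<and> A \<subseteq> {..<m} \<and> (\<forall>w\<in>A. resolves (nat_path m) i j w)"
      if "3 \<le> card (A \<inter> ?S)" "A \<subseteq> {..<m}" "\<And>w. w \<in> A \<Longrightarrow> resolves (nat_path m) i j w" for A
      using that by blast
    consider "j = i + 1" | "j = i + 2" | "i + 3 \<le> j" using ij by linarith
    hence "\<exists>A. 3 \<le> card (A \<inter> ?S) \<and> A \<subseteq> {..<m} \<and> (\<forall>w\<in>A. resolves (nat_path m) i j w)"
    proof cases
      case j: 1
      consider "i = 0" | "Suc j = m" "i \<noteq> 0" | "i \<noteq> 0" "Suc j < m" using ij by linarith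
      thus ?thesis
      proof cases
        case 1
        show ?thesis
          by (rule wit[of "{0, 1, 2}"], subst border)
            (use 1 j m in \<open>auto simp: card_insert_if resolves_nat_path\<close>)
      next
        case 2
        show ?thesis
          by (rule wit[of "{i - 1, i, i + 1}"], subst border)
            (use 2 j m in \<open>auto simp: card_insert_if resolves_nat_path\<close>)
      next
        case 3
        have "3 \<le> card ({i - 1, i, i + 1, i + 2} \<inter> ?S)"
          by (rule near[of _ "i - 1"]) (use 3 j in \<open>auto simp: card_insert_if\<close>)
        thus ?thesis
          by (rule wit) (use 3 j m in \<open>auto simp: card_insert_if resolves_nat_path\<close>)
      qed
    next
      case j: 2
      consider "i = 0" | "Suc j = m" "i \<noteq> 0" | "i \<noteq> 0" "Suc j < m" using ij by linarith
      thus ?thesis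
      proof cases
        case 1
        show ?thesis
          by (rule wit[of "{0, 2, 3}"], subst border)
            (use 1 j m in \<open>auto simp: card_insert_if resolves_nat_path\<close>)
      next
        case 2
        show ?thesis
          by (rule wit[of "{i - 1, i, i + 2}"], subst border)
            (use 2 j m in \<open>auto simp: card_insert_if resolves_nat_path\<close>)
      next
        case 3
        have "3 \<le> card ({i - 1, i, i + 2, i + 3} \<inter> ?S)"
          by (rule near[of _ "i - 1"]) (use 3 j in \<open>auto simp: card_insert_if\<close>)
        thus ?thesis
          by (rule wit) (use 3 j m in \<open>auto simp: card_insert_if resolves_nat_path\<close>)
      qed
    next
      case j: 3
      define L where "L = {i - 1, i, i + 1}"
      \<comment> \<open>\<open>m\<close> is removed because \<open>j\<close> may be the last vertex; for \<open>i = 0\<close> truncation makes \<open>L = {0, 1}\<close>.\<close>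
      define R where "R = {j - 1, j, j + 1} - {m}"
      have sub: "L \<subseteq> {..<m}" "R \<subseteq> {..<m}"
        using ij j by (auto simp: L_def R_def)
      have "2 \<le> card (L \<inter> ?S)"
      proof (cases "i = 0")
        case True
        with border[of L] m show ?thesis by (auto simp: L_def)
      next
        case False
        with sub show ?thesis
          by (intro near[of _ "i - 1"]) (auto simp: L_def card_insert_if)
      qed
      moreover have "2 \<le> card (R \<inter> ?S)"
      proof (cases "Suc j = m")
        case True
        hence "R = {j - 1, j}"
          using ij by (auto simp: R_def)
        with border[of R] m True j show ?thesis by (auto simp: card_insert_if)
      next
        case False
        hence "R = {j - 1, j, j + 1}"
          using ij by (auto simp: R_def)
        with sub ij show ?thesis
          by (intro near[of _ "j - 1"]) (auto simp: card_insert_if)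
      qed
      moreover have disj: "L \<inter> R = {}"
        using j by (auto simp: L_def R_def)
      have "finite L" "finite R"
        by (simp_all add: L_def R_def)
      with disj have "card ((L \<union> R) \<inter> ?S) = card (L \<inter> ?S) + card (R \<inter> ?S)"
        unfolding Int_Un_distrib2
        by (intro card_Un_disjoint) blast+
      ultimately have "3 \<le> card ((L \<union> R) \<inter> ?S)"
        by simp
      moreover have "resolves (nat_path m) i j w" if "w \<in> L \<union> R" for w
      proof -
        have "w < m"
          using that sub by blast
        have "w = i \<or> w = Suc i \<or> i = Suc w \<or> w = j \<or> w = Suc j \<or> j = Suc w"
          using that by (auto simp: L_def R_def)
        hence "(w = i \<or> w = Suc i \<or> i = Suc w) \<noteq> (w = j \<or> w = Suc j \<or> j = Suc w)"
          using j by linarith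
        with \<open>w < m\<close> ij show ?thesis
          by (simp add: resolves_nat_path) blast
      qed
      ultimately show ?thesis
        using sub by (intro wit[of "L \<union> R"]) simp_all
    qed
    thus "\<exists>A. 3 \<le> card (A \<inter> ?S) \<and> finite A \<and> (\<forall>w\<in>A \<inter> ?S. resolves (nat_path m) i j w)"
      by (meson IntD1 finite_lessThan finite_subset)
  qed auto
  moreover have "card ?S \<le> m - (m - 4) div 5"
  proof -
    have "(\<lambda>q. 5 * q + 4) ` {..<(m - 4) div 5} \<subseteq> ?T"
      by auto
    moreover have "finite ?T"
      by (rule finite_subset[of _ "{..m}"]) auto
    ultimately have "card ((\<lambda>q. 5 * q + 4) ` {..<(m - 4) div 5}) \<le> card ?T"
      by (intro card_mono)
    moreover have "card ((\<lambda>q. 5 * q + 4) ` {..<(m - 4) div 5}) = (m - 4) div 5"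
      by (simp add: card_image inj_on_def)
    moreover have "card ?S = m - card ?T"
      using \<open>finite ?T\<close> by (subst card_Diff_subset) auto
    ultimately show ?thesis by (simp add: diff_le_mono2)
  qed
  ultimately show ?thesis by blast
qed

section \<open>Coronas of paths\<close>

lemma is_path_graph_k_adjacency_dim:
  assumes P: "is_path_graph m P"
    and upper: "\<exists>S. k_adjacency_generator k (nat_path m) S \<and> card S \<le> s"
    and lower: "\<And>S. k_adjacency_generator k (nat_path m) S \<Longrightarrow> s \<le> card S"
  shows "k_adjacency_dim k P = s" and "\<exists>S. k_adjacency_generator k P S"
proof -
  obtain S where S: "k_adjacency_generator k (nat_path m) S" "card S \<le> s"
    using upper by blast
  have "card S = s"
    using S(2) lower[OF S(1)] by simp
  with S(1) lower have s: "k_adjacency_dim k (nat_path m) = s"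
    by (intro k_adjacency_dim_eqI)
  obtain f where f: "bij_betw f (pverts (nat_path m)) (pverts P)"
    "\<And>i j. i \<in> pverts (nat_path m) \<Longrightarrow> j \<in> pverts (nat_path m) \<Longrightarrow>
       (f i, f j) \<in> parcs P \<longleftrightarrow> (i, j) \<in> parcs (nat_path m)"
    using P by (rule is_path_graph_iso) blast
  show "k_adjacency_dim k P = s"
    using k_adjacency_dim_iso[OF f S(1)] s by simp
  show "\<exists>S. k_adjacency_generator k P S"
    using k_adjacency_generator_iso(1)[OF f S(1)] by blast
qed

lemma k_metric_dim_corona_paths:
  fixes P :: "nat \<Rightarrow> 'b pair_pre_digraph"
  assumes G: "pair_graph G" "Digraph_Component.connected (with_proj G)" "2 \<le> n"
      "bij_betw v {1..n} (pverts G)"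
    and P: "\<And>i. i \<in> {1..n} \<Longrightarrow> is_path_graph (m i) (P i)"
    and m: "\<And>i. i \<in> {1..n} \<Longrightarrow> 2 \<le> m i"
    and upper: "\<And>i. i \<in> {1..n} \<Longrightarrow> \<exists>S. k_adjacency_generator k (nat_path (m i)) S \<and> card S \<le> s i"
    and lower: "\<And>i S. i \<in> {1..n} \<Longrightarrow> k_adjacency_generator k (nat_path (m i)) S \<Longrightarrow> s i \<le> card S"
    and large: "\<And>i. i \<in> {1..n} \<Longrightarrow> k + 2 \<le> s i"
  shows "k_metric_dim k (corona n v G P) = (\<Sum>i=1..n. s i)"
    and "k_metric_dim k (corona n v G (\<lambda>i. complement_graph (P i))) = (\<Sum>i=1..n. s i)"
    and "k_metric_dim k (corona n v G (\<lambda>i. join_K1 (P i))) = (\<Sum>i=1..n. s i)"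
proof -
  have graph: "pair_graph (P i)" if "i \<in> {1..n}" for i
    using P[OF that] by (rule pair_graph_is_path_graph)
  have dim: "k_adjacency_dim k (P i) = s i" and gen: "\<exists>S. k_adjacency_generator k (P i) S"
    if "i \<in> {1..n}" for i
    using is_path_graph_k_adjacency_dim[OF P[OF that] upper[OF that] lower[OF that]] by blast+
  have card_P: "2 \<le> card (pverts (P i))" if "i \<in> {1..n}" for i
    using is_path_graph_card[OF P[OF that]] m[OF that] by simp
  have dim_join: "k_adjacency_dim k (join_K1 (P i)) = s i"
    and gen_join: "\<exists>S. k_adjacency_generator k (join_K1 (P i)) S" if i: "i \<in> {1..n}" for i
    using k_adjacency_dim_join[OF graph[OF i] gen[OF i], of 2] is_path_graph_degree[OF P[OF i]]
      large[OF i] dim[OF i] by simp_all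
  have card_join: "2 \<le> card (pverts (join_K1 (P i)))" if "i \<in> {1..n}" for i
    using card_P[OF that] pair_graph_finite[OF graph[OF that]]
    by (simp add: pverts_join card_image)

  interpret paths: corona_product G n v P
    using G graph by (intro corona_product.intro corona_product_axioms.intro)
  interpret complements: corona_product G n v "\<lambda>i. complement_graph (P i)"
    using G graph by (intro corona_product.intro corona_product_axioms.intro pair_graph_complement)
  interpret joins: corona_product G n v "\<lambda>i. join_K1 (P i)"
    using G graph by (intro corona_product.intro corona_product_axioms.intro pair_graph_join)
  show "k_metric_dim k (corona n v G P) = (\<Sum>i=1..n. s i)"
    using paths.k_metric_dim_corona[OF gen card_P] dim by simp
  show "k_metric_dim k (corona n v G (\<lambda>i. complement_graph (P i))) = (\<Sum>i=1..n. s i)"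
    using complements.k_metric_dim_corona[of k] gen card_P dim
    by (simp add: k_adjacency_generator_complement k_adjacency_dim_complement pverts_complement)
  show "k_metric_dim k (corona n v G (\<lambda>i. join_K1 (P i))) = (\<Sum>i=1..n. s i)"
    using joins.k_metric_dim_corona[OF gen_join card_join] dim_join by simp
qed

theorem proposition41:
  fixes G :: "'a pair_pre_digraph"
    and n :: nat
    and v :: "nat \<Rightarrow> 'a"
    and P :: "nat \<Rightarrow> 'b pair_pre_digraph"
    and m :: "nat \<Rightarrow> nat"
  assumes "pair_graph G"
    and "Digraph_Component.connected (with_proj G)"
    and "2 \<le> n"
    and "bij_betw v {1..n} (pverts G)"
    and "\<forall>i \<in> {1..n}. is_path_graph (m i) (P i)"
  shows
    "((\<forall>i \<in> {1..n}. 7 \<le> m i) \<longrightarrow>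
        k_metric_dim 1 (corona n v G P)
          = k_metric_dim 1 (corona n v G (\<lambda>i. complement_graph (P i)))
      \<and> k_metric_dim 1 (corona n v G (\<lambda>i. complement_graph (P i)))
          = k_metric_dim 1 (corona n v G (\<lambda>i. join_K1 (P i)))
      \<and> int (k_metric_dim 1 (corona n v G (\<lambda>i. join_K1 (P i))))
          = (\<Sum>i = 1..n. \<lfloor>(2 * real (m i) + 2) / 5\<rfloor>))
   \<and> ((\<forall>i \<in> {1..n}. 6 \<le> m i) \<longrightarrow>
        k_metric_dim 2 (corona n v G P)
          = k_metric_dim 2 (corona n v G (\<lambda>i. complement_graph (P i)))
      \<and> k_metric_dim 2 (corona n v G (\<lambda>i. complement_graph (P i)))
          = k_metric_dim 2 (corona n v G (\<lambda>i. join_K1 (P i)))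
      \<and> int (k_metric_dim 2 (corona n v G (\<lambda>i. join_K1 (P i))))
          = (\<Sum>i = 1..n. \<lceil>(real (m i) + 1) / 2\<rceil>))
   \<and> ((\<forall>i \<in> {1..n}. 6 \<le> m i) \<longrightarrow>
        k_metric_dim 3 (corona n v G P)
          = k_metric_dim 3 (corona n v G (\<lambda>i. complement_graph (P i)))
      \<and> k_metric_dim 3 (corona n v G (\<lambda>i. complement_graph (P i)))
          = k_metric_dim 3 (corona n v G (\<lambda>i. join_K1 (P i)))
      \<and> int (k_metric_dim 3 (corona n v G (\<lambda>i. join_K1 (P i))))
          = (\<Sum>i = 1..n. int (m i) - \<lfloor>(real (m i) - 4) / 5\<rfloor>))"
proof (intro conjI[of "_ \<longrightarrow> _"] impI)
  have P: "is_path_graph (m i) (P i)" if "i \<in> {1..n}" for i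
    using assms(5) that by blast
  note dims = k_metric_dim_corona_paths[OF assms(1-4) P]
  {
    assume "\<forall>i \<in> {1..n}. 7 \<le> m i"
    hence m: "7 \<le> m i" if "i \<in> {1..n}" for i
      using that by blast
    have bounds: "2 \<le> m i" "1 + 2 \<le> (2 * m i + 2) div 5" "0 < m i" if "i \<in> {1..n}" for i
      using m[OF that] by simp_all
    have "\<lfloor>(2 * real a + 2) / 5\<rfloor> = int ((2 * a + 2) div 5)" for a
      using floor_divide_of_nat_eq[of "2 * a + 2" 5, where 'a = real] by (simp add: add.commute)
    thus "k_metric_dim 1 (corona n v G P)
          = k_metric_dim 1 (corona n v G (\<lambda>i. complement_graph (P i)))
        \<and> k_metric_dim 1 (corona n v G (\<lambda>i. complement_graph (P i)))
          = k_metric_dim 1 (corona n v G (\<lambda>i. join_K1 (P i)))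
        \<and> int (k_metric_dim 1 (corona n v G (\<lambda>i. join_K1 (P i))))
          = (\<Sum>i = 1..n. \<lfloor>(2 * real (m i) + 2) / 5\<rfloor>)"
      using dims[OF _ bounds(1) nat_path_adjacency_dim_1_upper nat_path_adjacency_dim_1_lower[OF bounds(3)] bounds(2)]
      by simp
  next
    assume "\<forall>i \<in> {1..n}. 6 \<le> m i"
    hence m: "6 \<le> m i" if "i \<in> {1..n}" for i
      using that by blast
    have bounds: "2 \<le> m i" "2 + 2 \<le> m i div 2 + 1" "0 < m i" if "i \<in> {1..n}" for i
      using m[OF that] by simp_all
    have "\<lceil>(real a + 1) / 2\<rceil> = int (a div 2 + 1)" for a
    proof (cases "even a")
      case True
      then obtain b where "a = 2 * b" by (rule evenE)
      thus ?thesis by (intro ceiling_unique) simp_all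
    next
      case False
      then obtain b where "a = 2 * b + 1" by (rule oddE)
      thus ?thesis by (intro ceiling_unique) simp_all
    qed
    thus "k_metric_dim 2 (corona n v G P)
          = k_metric_dim 2 (corona n v G (\<lambda>i. complement_graph (P i)))
        \<and> k_metric_dim 2 (corona n v G (\<lambda>i. complement_graph (P i)))
          = k_metric_dim 2 (corona n v G (\<lambda>i. join_K1 (P i)))
        \<and> int (k_metric_dim 2 (corona n v G (\<lambda>i. join_K1 (P i))))
          = (\<Sum>i = 1..n. \<lceil>(real (m i) + 1) / 2\<rceil>)"
      using dims[OF _ bounds(1) nat_path_adjacency_dim_2_upper[OF bounds(3)] nat_path_adjacency_dim_2_lower[OF m] bounds(2)]
      by simp
  next
    assume "\<forall>i \<in> {1..n}. 6 \<le> m i"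
    hence m: "6 \<le> m i" if "i \<in> {1..n}" for i
      using that by blast
    have bounds: "2 \<le> m i" "3 + 2 \<le> m i - (m i - 4) div 5" if "i \<in> {1..n}" for i
      using m[OF that] by simp_all
    have "int (m i) - \<lfloor>(real (m i) - 4) / 5\<rfloor> = int (m i - (m i - 4) div 5)" if "i \<in> {1..n}" for i
      using m[OF that] floor_divide_of_nat_eq[of "m i - 4" 5, where 'a = real]
      by (simp add: of_nat_diff)
    thus "k_metric_dim 3 (corona n v G P)
          = k_metric_dim 3 (corona n v G (\<lambda>i. complement_graph (P i)))
        \<and> k_metric_dim 3 (corona n v G (\<lambda>i. complement_graph (P i)))
          = k_metric_dim 3 (corona n v G (\<lambda>i. join_K1 (P i)))
        \<and> int (k_metric_dim 3 (corona n v G (\<lambda>i. join_K1 (P i))))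
          = (\<Sum>i = 1..n. int (m i) - \<lfloor>(real (m i) - 4) / 5\<rfloor>)"
      using dims[OF _ bounds(1) nat_path_adjacency_dim_3_upper[OF m] nat_path_adjacency_dim_3_lower[OF m] bounds(2)]
      by simp
  }
qed

end
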